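(* Let $G$ be a finite graph with a perfect matching. Then $mp_f(G)=1/L(G)$.
   Context: Let $\mathcal{M}(G)$ be the set of perfect matchings of $G$, and for $S\subseteq E(G)$ let $\bm{q}^S\in\mathbb{R}^{E(G)}$ be its incidence vector (entry $1$ at $e\in S$, $0$ otherwise). The fractional matching preclusion number $mp_f(G)$ is the optimal value of the linear program: minimize $\bm{1}^T\bm{y}$ over $\bm{y}\in\mathbb{R}^{E(G)}$ subject to $(\bm{q}^M)^T\bm{y}\geqslant 1$ for every $M\in\mathcal{M}(G)$ and $\bm{y}\geqslant 0$. For a vertex $v$, $\bm{\partial}_G(v)$ is the row vector (incidence vector) of the set of edges incident with $v$. For $X\subseteq V(G)$, the edge cut $\partial_G(X)$ is the set of edges with exactly one end in $X$; it is an odd cut if $|X|$ and $|V(G)\setminus X|$ are both odd, and it is trivial if $|X|=1$ or $|V(G)\setminus X|=1$. $L(G)$ is the optimal value of the linear program (LP) in variables $z\in\mathbb{R}$, $\bm{b}\in\mathbb{R}^{E(G)}$: minimize $z$ subject to $z-b_e\geqslant 0$ for every $e\in E(G)$; $\bm{\partial}_G(v)\bm{b}=1$ for every $v\in V(G)$; $(\bm{q}^C)^T\bm{b}\geqslant 1$ for every non-trivial odd cut $C$ of $G$; $\bm{b}\geqslant 0$. *)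

theory Defs
  imports Complex_Main "HOL-Library.Indicator_Function" "HOL-Library.Disjoint_Sets"
begin

text \<open>
  Undirected graphs, parallel edges allowed (a simple graph is the case where \<open>ends\<close> is
  injective on the edges).  Loops are excluded, since with loops the claimed identity fails:
  take one edge \<open>uv\<close> together with a loop at \<open>u\<close> and a loop at \<open>v\<close>.  The vertex set is nonempty,
  since for the null graph neither linear program below has an optimal value.
\<close>

record ('v, 'e) ugraph =
  verts :: "'v set"
  edges :: "'e set"
  ends :: "'e \<Rightarrow> 'v set"

definition finite_graph :: "('v, 'e) ugraph \<Rightarrow> bool" where
  "finite_graph G \<longleftrightarrow>
     finite (verts G) \<and> verts G \<noteq> {} \<and> finite (edges G) \<and>
     (\<forall>e\<in>edges G. ends G e \<subseteq> verts G \<and> card (ends G e) = 2)"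

definition matching :: "('v, 'e) ugraph \<Rightarrow> 'e set \<Rightarrow> bool" where
  "matching G M \<longleftrightarrow> M \<subseteq> edges G \<and> disjoint_family_on (ends G) M"

definition perfect_matching :: "('v, 'e) ugraph \<Rightarrow> 'e set \<Rightarrow> bool" where
  "perfect_matching G M \<longleftrightarrow> matching G M \<and> (\<forall>v\<in>verts G. \<exists>e\<in>M. v \<in> ends G e)"

definition incident_edges :: "('v, 'e) ugraph \<Rightarrow> 'v \<Rightarrow> 'e set" where
  "incident_edges G v = {e \<in> edges G. v \<in> ends G e}"

definition edge_cut :: "('v, 'e) ugraph \<Rightarrow> 'v set \<Rightarrow> 'e set" where
  "edge_cut G X = {e \<in> edges G. card (ends G e \<inter> X) = 1}"

definition nontrivial_odd_cut :: "('v, 'e) ugraph \<Rightarrow> 'e set \<Rightarrow> bool" where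
  "nontrivial_odd_cut G C \<longleftrightarrow>
     (\<exists>X \<subseteq> verts G. C = edge_cut G X \<and>
        odd (card X) \<and> odd (card (verts G - X)) \<and>
        card X \<noteq> 1 \<and> card (verts G - X) \<noteq> 1)"

text \<open>
  A vector indexed by the edges is a function \<open>'e \<Rightarrow> real\<close> of which only the values on \<open>edges G\<close>
  are ever used.  The incidence vector of \<open>S\<close> is \<open>indicator S\<close>.
\<close>

definition edge_dot :: "('v, 'e) ugraph \<Rightarrow> ('e \<Rightarrow> real) \<Rightarrow> ('e \<Rightarrow> real) \<Rightarrow> real" where
  "edge_dot G x y = (\<Sum>e\<in>edges G. x e * y e)"

definition mp_f_feasible :: "('v, 'e) ugraph \<Rightarrow> ('e \<Rightarrow> real) \<Rightarrow> bool" where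
  "mp_f_feasible G y \<longleftrightarrow>
     (\<forall>M. perfect_matching G M \<longrightarrow> edge_dot G (indicator M) y \<ge> 1) \<and>
     (\<forall>e\<in>edges G. y e \<ge> 0)"

definition mp_f :: "('v, 'e) ugraph \<Rightarrow> real" where
  "mp_f G = Inf {edge_dot G (\<lambda>_. 1) y | y. mp_f_feasible G y}"

definition L_feasible :: "('v, 'e) ugraph \<Rightarrow> real \<Rightarrow> ('e \<Rightarrow> real) \<Rightarrow> bool" where
  "L_feasible G z b \<longleftrightarrow>
     (\<forall>e\<in>edges G. z - b e \<ge> 0) \<and>
     (\<forall>v\<in>verts G. edge_dot G (indicator (incident_edges G v)) b = 1) \<and>
     (\<forall>C. nontrivial_odd_cut G C \<longrightarrow> edge_dot G (indicator C) b \<ge> 1) \<and>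
     (\<forall>e\<in>edges G. b e \<ge> 0)"

text \<open>
  For a graph with a perfect matching both programs are feasible with objective bounded below
  by \<open>0\<close>, so the real infimum is the optimal value.
\<close>

definition L :: "('v, 'e) ugraph \<Rightarrow> real" where
  "L G = Inf {z | z b. L_feasible G z b}"

end

theory Submission
  imports Defs
begin

text \<open>
  By Edmonds' theorem the feasible \<open>b\<close> of \<open>L\<close> form the perfect matching polytope, so \<open>1 / L\<close> and
  \<open>mp_f\<close> are, up to normalisation, the two sides of a matrix game of edges against perfect
  matchings. Weak duality: for feasible \<open>y\<close> and \<open>(z, b)\<close> some perfect matching \<open>M\<close> satisfies
  \<open>1 \<le> y(M) \<le> y \<cdot> b \<le> z (1 \<cdot> y)\<close>. Conversely no point of the polytope has all coordinates below
  \<open>L\<close>; separating the polytope from the open orthant below \<open>(L, \<dots>, L)\<close> yields a probability vector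
  \<open>y\<close> with \<open>y(M) \<ge> L\<close> for all \<open>M\<close>, and \<open>y / L\<close> is optimal for \<open>mp_f\<close>.

  Edmonds' theorem is proved in the form: for every weight \<open>w\<close> and \<open>b\<close> in the polytope some perfect
  matching \<open>M\<close> has \<open>w(M) \<le> w \<cdot> b\<close>. Edges with \<open>b e = 0\<close> are deleted; at a tight nontrivial odd
  cut both shores are contracted in turn and the resulting matchings are glued along their common
  cut edge. Otherwise \<open>b\<close> is moved, without increasing \<open>w \<cdot> b\<close>, along a vector \<open>d\<close> that vanishes at
  every vertex until an edge or a cut becomes tight. Such a \<open>d \<noteq> 0\<close> exists unless \<open>b = 1\<close> on all
  edges: the edges with \<open>b e < 1\<close> form a graph of minimum degree 2, which either has more edges
  than vertices or is 2-regular, and then the odd cut constraints make its components even cycles.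
\<close>

section \<open>Finite linear systems\<close>

text \<open>Gaussian elimination: each induction step solves one equation for one unknown
  \<open>e0\<close> and substitutes it into the others.\<close>

lemma homogeneous_system_nontrivial_solution:
  fixes a :: "'v \<Rightarrow> 'e \<Rightarrow> real"
  assumes "finite V" "finite E" "card V < card E"
  shows "\<exists>d. (\<exists>e\<in>E. d e \<noteq> 0) \<and> (\<forall>v\<in>V. (\<Sum>e\<in>E. a v e * d e) = 0)"
  using assms
proof (induction V arbitrary: E a rule: finite_induct)
  case empty
  then have "E \<noteq> {}" by auto
  then show ?case by (intro exI[of _ "\<lambda>_. 1"]) auto
next
  case (insert v V)
  show ?case
  proof (cases "\<forall>e\<in>E. a v e = 0")
    case True
    have "card V < card E" using insert by simp
    from insert.IH[OF \<open>finite E\<close> this, of a] True show ?thesis by auto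
  next
    case False
    then obtain e0 where e0: "e0 \<in> E" "a v e0 \<noteq> 0" by auto
    let ?F = "E - {e0}"
    define a' where "a' u e = a u e - a u e0 * a v e / a v e0" for u e
    have "finite ?F" "card V < card ?F" using insert e0 by auto
    from insert.IH[OF this, of a'] obtain d where
      d: "\<exists>e\<in>?F. d e \<noteq> 0" "\<forall>u\<in>V. (\<Sum>e\<in>?F. a' u e * d e) = 0" by auto
    define x where "x = - (\<Sum>e\<in>?F. a v e * d e) / a v e0"
    define d' where "d' = d(e0 := x)"
    have "(\<Sum>e\<in>?F. a u e * d' e) = (\<Sum>e\<in>?F. a u e * d e)" for u
      by (rule sum.cong) (auto simp: d'_def)
    then have sum_d': "(\<Sum>e\<in>E. a u e * d' e) = a u e0 * x + (\<Sum>e\<in>?F. a u e * d e)" for u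
      using sum.remove[OF \<open>finite E\<close> \<open>e0 \<in> E\<close>, of "\<lambda>e. a u e * d' e"]
      by (simp add: d'_def)
    have "(\<Sum>e\<in>E. a u e * d' e) = 0" if "u \<in> V" for u
    proof -
      have "0 = (\<Sum>e\<in>?F. a u e * d e - (a u e0 / a v e0) * (a v e * d e))"
        using d(2) that by (simp add: a'_def algebra_simps)
      also have "\<dots> = (\<Sum>e\<in>?F. a u e * d e) - (a u e0 / a v e0) * (\<Sum>e\<in>?F. a v e * d e)"
        by (simp only: sum_subtractf sum_distrib_left)
      finally show ?thesis unfolding sum_d' x_def by simp
    qed
    moreover have "(\<Sum>e\<in>E. a v e * d' e) = 0"
      unfolding sum_d' x_def using e0 by simp
    moreover have "\<exists>e\<in>E. d' e \<noteq> 0" using d(1) by (auto simp: d'_def)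
    ultimately show ?thesis by auto
  qed
qed

text \<open>Separates a convex set from the open negative orthant, one coordinate at a time:
  induction handles the part of \<open>K\<close> with negative coordinate \<open>k\<close>, then a
  weight for \<open>k\<close> is fitted. Total weight 1 excludes the zero functional.\<close>

lemma convex_negative_point_or_nonneg_functional:
  fixes K :: "('j \<Rightarrow> real) set"
  assumes "finite J" "J \<noteq> {}"
    and "\<And>x y t. \<lbrakk>x \<in> K; y \<in> K; 0 \<le> t; t \<le> 1\<rbrakk> \<Longrightarrow> (\<lambda>j. (1 - t) * x j + t * y j) \<in> K"
  shows "(\<exists>x\<in>K. \<forall>j\<in>J. x j < 0) \<or>
    (\<exists>y. (\<forall>j\<in>J. 0 \<le> y j) \<and> (\<Sum>j\<in>J. y j) = 1 \<and> (\<forall>x\<in>K. 0 \<le> (\<Sum>j\<in>J. y j * x j)))"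
  using assms
proof (induction J arbitrary: K rule: finite_ne_induct)
  case (singleton k)
  show ?case
  proof (cases "\<exists>x\<in>K. x k < 0")
    case False
    then show ?thesis by (intro disjI2 exI[of _ "\<lambda>_. 1"]) (auto simp: not_less)
  qed auto
next
  case (insert k J)
  define K' where "K' = {x \<in> K. x k < 0}"
  note K = insert.prems
  show ?case
  proof (cases "K' = {}")
    case True
    then show ?thesis using insert.hyps
      by (intro disjI2 exI[of _ "\<lambda>j. if j = k then 1 else 0"])
        (auto simp: K'_def not_less sum.delta' if_distrib[of "\<lambda>u. u * _"] cong: if_cong)
  next
    case False
    then obtain n0 where n0: "n0 \<in> K" "n0 k < 0" by (auto simp: K'_def)
    have "(\<lambda>j. (1 - t) * x j + t * y j) \<in> K'"
      if "x \<in> K'" "y \<in> K'" "0 \<le> t" "t \<le> 1" for x y t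
    proof -
      have "(1 - t) * x k + t * y k < 0"
      proof (cases "t = 0")
        case False
        then have "t * y k < 0" "(1 - t) * x k \<le> 0"
          using that by (auto simp: K'_def mult_pos_neg mult_nonneg_nonpos)
        then show ?thesis by simp
      qed (use that in \<open>auto simp: K'_def\<close>)
      then show ?thesis using that K by (auto simp: K'_def)
    qed
    note IH = insert.IH[OF this]
    show ?thesis
    proof (cases "\<exists>x\<in>K'. \<forall>j\<in>J. x j < 0")
      case True
      then show ?thesis by (auto simp: K'_def)
    next
      case no_neg: False
      with IH obtain y where y: "\<forall>j\<in>J. 0 \<le> y j" "(\<Sum>j\<in>J. y j) = 1"
        "\<forall>x\<in>K'. 0 \<le> (\<Sum>j\<in>J. y j * x j)" by auto
      define f where "f x = (\<Sum>j\<in>J. y j * x j)" for x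
      have f_comb: "f (\<lambda>j. (1 - t) * p j + t * n j) = (1 - t) * f p + t * f n" for p n t
        unfolding f_def by (simp add: sum_distrib_left sum.distrib[symmetric] algebra_simps)
      have f_nonneg: "0 \<le> f x" if "x \<in> K" "x k < 0" for x
        using y(3) that by (auto simp: f_def K'_def)
      \<comment> \<open>Points with positive coordinate \<open>k\<close> bound the weight of
        \<open>k\<close> from below, those with negative coordinate from above; this says that the
        bounds are compatible. If it failed, a point between \<open>p\<close> and \<open>n\<close>
        would lie in \<open>K'\<close> with \<open>f\<close> negative.\<close>
      have cross: "0 \<le> p k * f n - n k * f p"
        if pn: "p \<in> K" "0 \<le> p k" "n \<in> K" "n k < 0" for p n
      proof (rule ccontr)
        assume neg: "\<not> ?thesis"
        have fn: "0 \<le> f n" using f_nonneg pn by auto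
        \<comment> \<open>With \<epsilon> = 0 the point \<open>?x\<close> would have coordinate
          \<open>k\<close> equal to 0 and miss \<open>K'\<close>; a small \<epsilon> pushes it below
          0 and keeps \<open>f\<close> negative. The summand 1 guards against
          \<open>f n = 0\<close>.\<close>
        define \<epsilon> where "\<epsilon> = (n k * f p - p k * f n) / (2 * (f n + 1))"
        have eps: "\<epsilon> > 0" "\<epsilon> * f n < n k * f p - p k * f n"
        proof -
          let ?D = "n k * f p - p k * f n"
          have D: "?D > 0" using neg by simp
          show "\<epsilon> > 0" unfolding \<epsilon>_def using D fn by (intro divide_pos_pos) auto
          have "?D * f n < ?D * (2 * (f n + 1))" using D fn by (intro mult_strict_left_mono) auto
          then show "\<epsilon> * f n < ?D" unfolding \<epsilon>_def using fn by (simp add: field_simps)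
        qed
        define s where "s = p k + \<epsilon> - n k"
        have s: "s > 0" using pn eps by (simp add: s_def)
        define t where "t = (p k + \<epsilon>) / s"
        have t: "0 \<le> t" "t \<le> 1" "1 - t = - n k / s"
          using pn eps s by (auto simp: t_def s_def field_simps)
        let ?x = "\<lambda>j. (1 - t) * p j + t * n j"
        have "?x k = \<epsilon> * n k / s"
          unfolding t(3) by (simp add: t_def add_divide_distrib[symmetric] algebra_simps diff_divide_distrib[symmetric])
        moreover have "\<epsilon> * n k / s < 0" using eps s pn by (simp add: divide_neg_pos mult_pos_neg)
        ultimately have "?x k < 0" by linarith
        with f_nonneg[OF K[OF pn(1,3) t(1,2)]] have "0 \<le> f ?x" .
        moreover have "f ?x = (p k * f n - n k * f p + \<epsilon> * f n) / s"
          unfolding f_comb unfolding t(3) by (simp add: t_def add_divide_distrib[symmetric] algebra_simps diff_divide_distrib[symmetric])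
        moreover have "\<dots> < 0" using eps s by (intro divide_neg_pos) auto
        ultimately show False by simp
      qed
      \<comment> \<open>The lower bounds on the weight of \<open>k\<close>; the inserted 0 makes the
        supremum nonnegative.\<close>
      define R where "R = insert 0 {- f p / p k | p. p \<in> K \<and> 0 < p k}"
      have R_le: "r \<le> f n / (- n k)" if r: "r \<in> R" and "n \<in> K" "n k < 0" for r n
      proof -
        consider "r = 0" | p where "p \<in> K" "0 < p k" "r = - f p / p k"
          using r unfolding R_def by blast
        then show ?thesis
        proof cases
          case 1
          then show ?thesis using f_nonneg[OF that(2,3)] that by (simp add: divide_nonneg_neg divide_nonneg_pos)
        next
          case 2
          have "0 \<le> (p k * f n - n k * f p) / p k"
            using cross[OF 2(1) _ that(2,3)] 2 by (intro divide_nonneg_pos) auto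
          then have "r * (- n k) \<le> f n" using 2 by (simp add: diff_divide_distrib mult.commute)
          then show ?thesis using that(3) by (subst pos_le_divide_eq) auto
        qed
      qed
      have bdd: "bdd_above R" using R_le[OF _ n0] by (rule bdd_aboveI)
      define s where "s = Sup R"
      have s0: "0 \<le> s" unfolding s_def by (rule cSup_upper[OF _ bdd]) (simp add: R_def)
      have nonneg: "0 \<le> f x + s * x k" if x: "x \<in> K" for x
      proof (cases "x k" "0 :: real" rule: linorder_cases)
        case less
        have "s \<le> f x / (- x k)" unfolding s_def
          by (rule cSup_least) (use R_le x less in \<open>auto simp: R_def\<close>)
        then have "s * (- x k) \<le> f x" using less by (subst (asm) pos_le_divide_eq) auto
        then show ?thesis by simp
      next
        case equal
        then have "0 \<le> - n0 k * f x" using cross[OF x _ n0] by simp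
        then show ?thesis using n0 equal by (simp add: mult_le_0_iff)
      next
        case greater
        have "- f x / x k \<le> s" unfolding s_def
          by (rule cSup_upper[OF _ bdd]) (use x greater in \<open>auto simp: R_def\<close>)
        then show ?thesis using greater by (simp add: field_simps)
      qed
      define y' where "y' j = (if j = k then s else y j) / (1 + s)" for j
      have y'J: "(\<Sum>j\<in>J. y' j * c j) = (\<Sum>j\<in>J. y j * c j) / (1 + s)" for c
        unfolding sum_divide_distrib
        by (rule sum.cong) (use insert.hyps in \<open>auto simp: y'_def\<close>)
      have "\<forall>j\<in>insert k J. 0 \<le> y' j" using y s0 by (auto simp: y'_def)
      moreover have "(\<Sum>j\<in>insert k J. y' j) = 1"
        using y'J[of "\<lambda>_. 1"] insert.hyps y s0
        by (simp add: y'_def add_divide_distrib[symmetric])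
      moreover have "0 \<le> (\<Sum>j\<in>insert k J. y' j * x j)" if "x \<in> K" for x
      proof -
        have "(\<Sum>j\<in>insert k J. y' j * x j) = (f x + s * x k) / (1 + s)"
          using insert.hyps y'J[of x] by (simp add: y'_def f_def add_divide_distrib)
        then show ?thesis using nonneg[OF that] s0 by simp
      qed
      ultimately show ?thesis by blast
    qed
  qed
qed

text \<open>Ratio test. A pair \<open>(s, r)\<close> is a constraint with slack \<open>s\<close>
  changing at rate \<open>r\<close>; the least ratio \<open>s / (- r)\<close> over the decreasing
  constraints is the first time at which one becomes tight.\<close>

lemma first_vanishing_constraint:
  fixes R :: "(real \<times> real) set"
  assumes "finite R" "\<And>s r. (s, r) \<in> R \<Longrightarrow> 0 < s" "(s0, r0) \<in> R" "r0 < 0"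
  obtains t s r where "0 \<le> t" "\<And>s r. (s, r) \<in> R \<Longrightarrow> 0 \<le> s + t * r"
    "(s, r) \<in> R" "s + t * r = 0"
proof -
  define Q where "Q = {s / (- r) | s r. (s, r) \<in> R \<and> r < 0}"
  have "Q \<subseteq> (\<lambda>(s, r). s / (- r)) ` R" by (auto simp: Q_def)
  then have "finite Q" by (rule finite_surj[OF assms(1)])
  moreover have "Q \<noteq> {}" using assms(3,4) by (auto simp: Q_def)
  ultimately have Min: "Min Q \<in> Q" "\<And>q. q \<in> Q \<Longrightarrow> Min Q \<le> q" by auto
  then obtain s r where sr: "Min Q = s / (- r)" "(s, r) \<in> R" "r < 0" by (auto simp: Q_def)
  have "0 < Min Q" using sr assms(2)[of s r] by (simp add: divide_pos_neg)
  moreover have "0 \<le> s' + Min Q * r'" if "(s', r') \<in> R" for s' r'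
  proof (cases "r' < 0")
    case True
    then have "Min Q \<le> s' / (- r')" using that by (intro Min(2)) (auto simp: Q_def)
    then have "Min Q * (- r') \<le> s'" using True by (subst (asm) pos_le_divide_eq) auto
    then show ?thesis by simp
  next
    case False
    then show ?thesis using assms(2)[OF that] \<open>0 < Min Q\<close> by simp
  qed
  moreover have "s + Min Q * r = 0" using sr by simp
  ultimately show thesis using sr that[of "Min Q" s r] by auto
qed

section \<open>The perfect matching polytope\<close>

text \<open>Edmonds' description of the perfect matching polytope. The constraints range over odd
  vertex sets, trivial ones included, so that they pass to contractions by taking preimages.\<close>

definition pm_polytope :: "('v, 'e) ugraph \<Rightarrow> ('e \<Rightarrow> real) set" where
  "pm_polytope G = {b. (\<forall>e\<in>edges G. 0 \<le> b e) \<and>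
     (\<forall>v\<in>verts G. sum b (incident_edges G v) = 1) \<and>
     (\<forall>X\<subseteq>verts G. odd (card X) \<longrightarrow> 1 \<le> sum b (edge_cut G X))}"

lemma finite_graphD:
  assumes "finite_graph G"
  shows "finite (verts G)" "finite (edges G)" "finite (incident_edges G v)"
    "finite (edge_cut G X)" "e \<in> edges G \<Longrightarrow> ends G e \<subseteq> verts G"
    "e \<in> edges G \<Longrightarrow> card (ends G e) = 2" "e \<in> edges G \<Longrightarrow> finite (ends G e)"
  using assms by (auto simp: finite_graph_def incident_edges_def edge_cut_def intro: card_ge_0_finite)

section \<open>Edge cuts and incidence counts\<close>

lemma edge_cut_singleton: "edge_cut G {v} = incident_edges G v"
proof -
  have "card (A \<inter> {v}) = 1 \<longleftrightarrow> v \<in> A" for A by (cases "v \<in> A") simp_all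
  then show ?thesis by (simp add: edge_cut_def incident_edges_def)
qed

lemma edge_cut_Diff:
  assumes "finite_graph G"
  shows "edge_cut G (verts G - X) = edge_cut G X"
proof -
  have "card (ends G e \<inter> (verts G - X)) = 1 \<longleftrightarrow> card (ends G e \<inter> X) = 1" if "e \<in> edges G" for e
  proof -
    have "ends G e \<inter> (verts G - X) = ends G e - X"
      using finite_graphD(5)[OF assms that] by auto
    moreover have "card (ends G e) = card (ends G e \<inter> X) + card (ends G e - X)"
      by (rule card_Int_Diff) (rule finite_graphD(7)[OF assms that])
    ultimately show ?thesis using finite_graphD(6)[OF assms that] by auto
  qed
  then show ?thesis by (auto simp: edge_cut_def)
qed

lemma edge_cut_odd_iff:
  assumes "finite_graph G" "e \<in> edges G"
  shows "e \<in> edge_cut G X \<longleftrightarrow> odd (card (ends G e \<inter> X))"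
proof -
  have "card (ends G e \<inter> X) \<le> 2"
    using card_mono[OF finite_graphD(7)[OF assms], of "ends G e \<inter> X"] finite_graphD(6)[OF assms]
    by auto
  then have "card (ends G e \<inter> X) \<in> {0, 1, 2}" by auto
  then show ?thesis using assms by (auto simp: edge_cut_def)
qed

lemma edge_cut_iff:
  assumes "finite_graph G" "e \<in> edges G"
  shows "e \<in> edge_cut G X \<longleftrightarrow> \<not> ends G e \<subseteq> X \<and> ends G e \<inter> X \<noteq> {}"
proof -
  obtain u v where uv: "ends G e = {u, v}" "u \<noteq> v"
    using finite_graphD(6)[OF assms] by (meson card_2_iff)
  show ?thesis
    using assms(2) by (cases "u \<in> X"; cases "v \<in> X") (simp_all add: edge_cut_def uv)
qed

text \<open>Double counting of incident pairs of a vertex in \<open>X\<close> and an edge of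
  \<open>F\<close>. The semiring is general to serve both cardinalities in \<open>nat\<close> and
  real weights.\<close>

lemma sum_incident_edges:
  fixes g :: "'e \<Rightarrow> 'a :: comm_semiring_1"
  assumes "finite X" "finite F" "F \<subseteq> edges G"
  shows "(\<Sum>v\<in>X. sum g (F \<inter> incident_edges G v)) = (\<Sum>e\<in>F. of_nat (card (ends G e \<inter> X)) * g e)"
proof -
  have "(\<Sum>v\<in>X. sum g (F \<inter> incident_edges G v)) = (\<Sum>v\<in>X. \<Sum>e\<in>F. if v \<in> ends G e then g e else 0)"
  proof (rule sum.cong[OF refl])
    fix v assume "v \<in> X"
    have "F \<inter> incident_edges G v = {e \<in> F. v \<in> ends G e}"
      using assms by (auto simp: incident_edges_def)
    then show "sum g (F \<inter> incident_edges G v) = (\<Sum>e\<in>F. if v \<in> ends G e then g e else 0)"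
      using assms by (simp add: sum.inter_filter)
  qed
  also have "\<dots> = (\<Sum>e\<in>F. \<Sum>v\<in>X. if v \<in> ends G e then g e else 0)" by (rule sum.swap)
  also have "\<dots> = (\<Sum>e\<in>F. of_nat (card (ends G e \<inter> X)) * g e)"
    using assms by (intro sum.cong refl) (simp add: sum.If_cases Int_commute)
  finally show ?thesis .
qed

lemma sum_card_incident_edges:
  assumes "finite X" "finite F" "F \<subseteq> edges G"
  shows "(\<Sum>v\<in>X. card (F \<inter> incident_edges G v)) = (\<Sum>e\<in>F. card (ends G e \<inter> X))"
  using sum_incident_edges[OF assms, of "\<lambda>_. 1 :: nat"] by simp

lemma perfect_matching_iff:
  assumes "finite_graph G"
  shows "perfect_matching G M \<longleftrightarrow>
    M \<subseteq> edges G \<and> (\<forall>v\<in>verts G. card (M \<inter> incident_edges G v) = 1)"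
proof
  assume M: "perfect_matching G M"
  then have sub: "M \<subseteq> edges G" and disj: "disjoint_family_on (ends G) M"
    by (auto simp: perfect_matching_def matching_def)
  have "card (M \<inter> incident_edges G v) = 1" if v: "v \<in> verts G" for v
  proof -
    obtain e where e: "e \<in> M" "v \<in> ends G e" using M v by (auto simp: perfect_matching_def)
    have "M \<inter> incident_edges G v = {e}"
      using e sub disj by (fastforce simp: incident_edges_def disjoint_family_on_def)
    then show ?thesis by simp
  qed
  with sub show "M \<subseteq> edges G \<and> (\<forall>v\<in>verts G. card (M \<inter> incident_edges G v) = 1)" by auto
next
  assume M: "M \<subseteq> edges G \<and> (\<forall>v\<in>verts G. card (M \<inter> incident_edges G v) = 1)"
  have "ends G e \<inter> ends G f = {}" if ef: "e \<in> M" "f \<in> M" "e \<noteq> f" for e f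
  proof (rule ccontr)
    assume "\<not> ?thesis"
    then obtain v where v: "v \<in> ends G e" "v \<in> ends G f" by auto
    then have "v \<in> verts G" using ef M finite_graphD(5)[OF assms] by blast
    then obtain g where "M \<inter> incident_edges G v = {g}" using M by (meson card_1_singletonE)
    moreover have "{e, f} \<subseteq> M \<inter> incident_edges G v"
      using ef v M by (auto simp: incident_edges_def)
    ultimately show False using ef by auto
  qed
  moreover have "\<exists>e\<in>M. v \<in> ends G e" if "v \<in> verts G" for v
  proof -
    obtain g where "M \<inter> incident_edges G v = {g}" using M \<open>v \<in> verts G\<close> by (meson card_1_singletonE)
    then show ?thesis by (auto simp: incident_edges_def)
  qed
  ultimately show "perfect_matching G M"
    using M by (auto simp: perfect_matching_def matching_def disjoint_family_on_def)
qed

lemma perfect_matching_even_card_verts: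
  assumes "finite_graph G" "perfect_matching G M"
  shows "even (card (verts G))"
proof -
  have M: "M \<subseteq> edges G" "\<forall>v\<in>verts G. card (M \<inter> incident_edges G v) = 1"
    using assms perfect_matching_iff by auto
  have "card (verts G) = (\<Sum>v\<in>verts G. card (M \<inter> incident_edges G v))" using M by simp
  also have "\<dots> = (\<Sum>e\<in>M. card (ends G e \<inter> verts G))"
    by (rule sum_card_incident_edges)
      (use M finite_graphD[OF assms(1)] in \<open>auto intro: finite_subset\<close>)
  also have "\<dots> = (\<Sum>e\<in>M. 2)"
  proof (rule sum.cong[OF refl])
    fix e assume "e \<in> M"
    then have "ends G e \<inter> verts G = ends G e" "card (ends G e) = 2"
      using M finite_graphD(5,6)[OF assms(1)] by auto
    then show "card (ends G e \<inter> verts G) = 2" by simp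
  qed
  finally show ?thesis by simp
qed

text \<open>If a perfect matching avoids the cut of \<open>X\<close>, each of its edges has 0 or 2
  ends in \<open>X\<close>, and counting covered vertices makes \<open>card X\<close> even.\<close>

lemma indicator_perfect_matching_in_pm_polytope:
  assumes "finite_graph G" "perfect_matching G M"
  shows "indicator M \<in> pm_polytope G"
proof -
  have M: "M \<subseteq> edges G" "\<forall>v\<in>verts G. card (M \<inter> incident_edges G v) = 1"
    using assms perfect_matching_iff by auto
  have finM: "finite M" using M(1) finite_graphD(2)[OF assms(1)] by (rule finite_subset)
  have ind: "sum (indicator M) A = real (card (M \<inter> A))" if "finite A" for A
    using that by (simp add: indicator_def sum.If_cases Int_commute)
  have "1 \<le> card (M \<inter> edge_cut G X)" if X: "X \<subseteq> verts G" "odd (card X)" for X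
  proof (rule ccontr)
    assume "\<not> ?thesis"
    then have "card (M \<inter> edge_cut G X) = 0" by linarith
    then have "M \<inter> edge_cut G X = {}" using finM by (metis card_0_eq finite_Int)
    then have even: "\<forall>e\<in>M. even (card (ends G e \<inter> X))"
      using M edge_cut_odd_iff[OF assms(1)] by blast
    have finX: "finite X" using X finite_graphD(1)[OF assms(1)] finite_subset by auto
    have "card X = (\<Sum>v\<in>X. card (M \<inter> incident_edges G v))" using M(2) X by (simp add: subset_iff)
    also have "\<dots> = (\<Sum>e\<in>M. card (ends G e \<inter> X))"
      by (rule sum_card_incident_edges[OF finX finM M(1)])
    also have "even \<dots>" using even by (auto intro: dvd_sum)
    finally show False using X by simp
  qed
  then show ?thesis using M finite_graphD[OF assms(1)] by (auto simp: pm_polytope_def ind)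
qed

section \<open>The constraints of \<open>L\<close> in terms of the polytope\<close>

lemma edge_dot_indicator:
  assumes "finite_graph G" "A \<subseteq> edges G"
  shows "edge_dot G (indicator A) y = sum y A"
  using assms(2) finite_graphD(2)[OF assms(1)]
  by (simp add: edge_dot_def indicator_def if_distrib[of "\<lambda>u. u * _"] sum.If_cases Int_absorb1
      cong: if_cong)

text \<open>In even order the two shores of a cut are odd together. The odd cuts that
  \<open>L_feasible\<close> omits have a one-vertex shore, where the degree equation gives the value
  1.\<close>

lemma L_feasible_iff:
  assumes "finite_graph G" "even (card (verts G))"
  shows "L_feasible G z b \<longleftrightarrow> b \<in> pm_polytope G \<and> (\<forall>e\<in>edges G. b e \<le> z)"
proof -
  note dot = edge_dot_indicator[OF assms(1)]
  have inc: "incident_edges G v \<subseteq> edges G" for v by (auto simp: incident_edges_def)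
  have cut: "edge_cut G X \<subseteq> edges G" for X by (auto simp: edge_cut_def)
  have odd_compl: "odd (card (verts G - X)) \<longleftrightarrow> odd (card X)" if "X \<subseteq> verts G" for X
  proof -
    have "card (verts G) = card X + card (verts G - X)"
      using card_Int_Diff[OF finite_graphD(1)[OF assms(1)], of X] that by (simp add: Int_absorb1)
    then show ?thesis using assms(2) by presburger
  qed
  have trivial: "sum b (edge_cut G X) = 1"
    if deg: "\<forall>v\<in>verts G. sum b (incident_edges G v) = 1" and X: "X \<subseteq> verts G"
      and "card X = 1 \<or> card (verts G - X) = 1" for X
  proof -
    have *: "sum b (edge_cut G Y) = 1" if "Y \<subseteq> verts G" "card Y = 1" for Y
      using that deg by (auto simp: card_1_singleton_iff edge_cut_singleton)
    show ?thesis using *[of X] *[of "verts G - X"] that edge_cut_Diff[OF assms(1), of X] by auto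
  qed
  show ?thesis
  proof
    assume L: "L_feasible G z b"
    then have deg: "\<forall>v\<in>verts G. sum b (incident_edges G v) = 1"
      by (simp add: L_feasible_def dot inc)
    have "1 \<le> sum b (edge_cut G X)" if "X \<subseteq> verts G" "odd (card X)" for X
    proof (cases "card X = 1 \<or> card (verts G - X) = 1")
      case True
      then show ?thesis using trivial[OF deg that(1)] by simp
    next
      case False
      then have "nontrivial_odd_cut G (edge_cut G X)"
        using that odd_compl by (auto simp: nontrivial_odd_cut_def)
      then show ?thesis using L by (auto simp: L_feasible_def dot cut)
    qed
    then show "b \<in> pm_polytope G \<and> (\<forall>e\<in>edges G. b e \<le> z)"
      using L deg by (auto simp: L_feasible_def pm_polytope_def)
  next
    assume "b \<in> pm_polytope G \<and> (\<forall>e\<in>edges G. b e \<le> z)"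
    then show "L_feasible G z b"
      by (auto simp: L_feasible_def pm_polytope_def nontrivial_odd_cut_def dot cut inc)
  qed
qed

section \<open>Contracting an odd set of vertices\<close>

text \<open>Edges keep their names, and the new vertex is represented by an old one,
  \<open>x\<close>, taken from \<open>X\<close> in all uses; so one vector \<open>b\<close> can be
  read in \<open>G\<close> and in its contractions. Edges inside \<open>X\<close> would become loops
  and are dropped.\<close>

definition contract :: "('v, 'e) ugraph \<Rightarrow> 'v set \<Rightarrow> 'v \<Rightarrow> ('v, 'e) ugraph" where
  "contract G X x = \<lparr>verts = insert x (verts G - X),
     edges = {e \<in> edges G. \<not> ends G e \<subseteq> X},
     ends = (\<lambda>e. (\<lambda>v. if v \<in> X then x else v) ` ends G e)\<rparr>"

text \<open>A surviving edge has an end outside \<open>X\<close>, so its two ends are not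
  identified: contraction creates no loops.\<close>

lemma inj_on_collapse_ends:
  assumes "finite_graph G" "e \<in> edges (contract G X x)" "x \<in> X"
  shows "inj_on (\<lambda>v. if v \<in> X then x else v) (ends G e)"
proof -
  have e: "e \<in> edges G" "\<not> ends G e \<subseteq> X" using assms by (auto simp: contract_def)
  then obtain u v where uv: "ends G e = {u, v}"
    using finite_graphD(6)[OF assms(1)] by (meson card_2_iff)
  with e have "u \<notin> X \<or> v \<notin> X" by simp
  with assms(3) have "(if u \<in> X then x else u) = (if v \<in> X then x else v) \<Longrightarrow> u = v"
    by (cases "u \<in> X"; cases "v \<in> X") auto
  then show ?thesis unfolding uv inj_on_def by (metis empty_iff insert_iff)
qed

lemma finite_graph_contract:
  assumes "finite_graph G" "X \<subseteq> verts G" "x \<in> X"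
  shows "finite_graph (contract G X x)"
proof -
  have "card (ends (contract G X x) e) = 2" "ends (contract G X x) e \<subseteq> verts (contract G X x)"
    if e: "e \<in> edges (contract G X x)" for e
  proof -
    have "e \<in> edges G" using e by (auto simp: contract_def)
    then show "card (ends (contract G X x) e) = 2"
      using card_image[OF inj_on_collapse_ends[OF assms(1) e assms(3)]] finite_graphD(6)[OF assms(1)]
      by (simp add: contract_def)
    show "ends (contract G X x) e \<subseteq> verts (contract G X x)"
      using finite_graphD(5)[OF assms(1) \<open>e \<in> edges G\<close>] by (auto simp: contract_def)
  qed
  then show ?thesis using finite_graphD[OF assms(1)]
    by (auto simp: finite_graph_def contract_def)
qed

text \<open>Cuts of the contraction are cuts of \<open>G\<close> along sets that contain
  \<open>X\<close> or avoid it.\<close>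

lemma edge_cut_contract:
  assumes "finite_graph G" "x \<in> X"
  shows "edge_cut (contract G X x) Y = edge_cut G ((\<lambda>v. if v \<in> X then x else v) -` Y)"
    (is "_ = edge_cut G (?f -` Y)")
proof -
  have 1: "card (ends (contract G X x) e \<inter> Y) = card (ends G e \<inter> ?f -` Y)"
    if e: "e \<in> edges (contract G X x)" for e
  proof -
    have "ends (contract G X x) e \<inter> Y = ?f ` (ends G e \<inter> ?f -` Y)"
      by (auto simp: contract_def simp del: if_image_distrib)
    moreover have "inj_on ?f (ends G e \<inter> ?f -` Y)"
      using inj_on_collapse_ends[OF assms(1) e assms(2)] by (rule inj_on_subset) auto
    ultimately show ?thesis by (simp only: card_image)
  qed
  have 2: "card (ends G e \<inter> ?f -` Y) \<noteq> 1" if e: "e \<in> edges G" "ends G e \<subseteq> X" for e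
  proof -
    have "ends G e \<inter> ?f -` Y = {} \<or> ends G e \<inter> ?f -` Y = ends G e"
      using e by (cases "x \<in> Y") auto
    then show ?thesis using finite_graphD(6)[OF assms(1) e(1)] by auto
  qed
  have 3: "e \<in> edges (contract G X x) \<longleftrightarrow> e \<in> edges G \<and> \<not> ends G e \<subseteq> X" for e
    by (simp add: contract_def)
  show ?thesis
  proof (rule set_eqI)
    fix e
    show "e \<in> edge_cut (contract G X x) Y \<longleftrightarrow> e \<in> edge_cut G (?f -` Y)"
    proof (cases "e \<in> edges (contract G X x)")
      case True
      with 1[OF True] 3[of e] show ?thesis unfolding edge_cut_def mem_Collect_eq by argo
    next
      case False
      with 2[of e] 3[of e] show ?thesis unfolding edge_cut_def mem_Collect_eq by argo
    qed
  qed
qed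

lemma incident_edges_contract:
  assumes "finite_graph G" "x \<in> X"
  shows "incident_edges (contract G X x) x = edge_cut G X"
    and "v \<notin> X \<Longrightarrow> incident_edges (contract G X x) v = incident_edges G v"
proof -
  have "(\<lambda>v. if v \<in> X then x else v) -` {x} = X" using assms(2) by (auto split: if_splits)
  then show "incident_edges (contract G X x) x = edge_cut G X"
    using edge_cut_contract[OF assms, of "{x}"] by (simp add: edge_cut_singleton)
  assume "v \<notin> X"
  then have "(\<lambda>v. if v \<in> X then x else v) -` {v} = {v}" using assms(2) by (auto split: if_splits)
  then show "incident_edges (contract G X x) v = incident_edges G v"
    using edge_cut_contract[OF assms, of "{v}"] by (simp add: edge_cut_singleton)
qed

text \<open>Tightness of the cut is the degree equation at the new vertex. Odd sets lift to odd
  sets, since trading \<open>x\<close> for \<open>X\<close> changes the cardinality by an even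
  number.\<close>

lemma pm_polytope_contract:
  assumes "finite_graph G" "X \<subseteq> verts G" "odd (card X)" "x \<in> X"
    and "b \<in> pm_polytope G" "sum b (edge_cut G X) = 1"
  shows "b \<in> pm_polytope (contract G X x)"
proof -
  let ?f = "\<lambda>v. if v \<in> X then x else v"
  have finV: "finite (verts G)" by (rule finite_graphD(1)[OF assms(1)])
  have "1 \<le> sum b (edge_cut (contract G X x) Y)"
    if Y: "Y \<subseteq> verts (contract G X x)" "odd (card Y)" for Y
  proof -
    have "?f -` Y \<subseteq> verts G"
      using Y assms by (auto simp: contract_def split: if_splits)
    moreover have "odd (card (?f -` Y))"
    proof (cases "x \<in> Y")
      case True
      define Z where "Z = Y - {x}"
      have Z: "Z \<inter> X = {}" "finite Z"
        using Y finV by (auto simp: Z_def contract_def intro: finite_subset)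
      have "?f -` Y = X \<union> Z" using True Z assms(4) by (auto simp: Z_def split: if_splits)
      moreover have "card (X \<union> Z) = card X + card Z"
        using Z assms(2) finV by (intro card_Un_disjoint) (auto intro: finite_subset)
      moreover have "card Y = Suc (card Z)"
        unfolding Z_def by (rule card.remove) (use True Z in \<open>auto simp: Z_def\<close>)
      ultimately show ?thesis using Y assms(3) by simp
    next
      case False
      then have "?f -` Y = Y" using Y by (auto simp: contract_def split: if_splits)
      then show ?thesis using Y by simp
    qed
    ultimately show ?thesis
      using assms(5) edge_cut_contract[OF assms(1,4)] by (auto simp: pm_polytope_def)
  qed
  moreover have "sum b (incident_edges (contract G X x) v) = 1"
    if "v \<in> verts (contract G X x)" for v
    using that incident_edges_contract[OF assms(1,4)] assms(5,6)
    by (auto simp: contract_def pm_polytope_def)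
  ultimately show ?thesis using assms(5) by (auto simp: pm_polytope_def contract_def)
qed

lemma even_card_verts_contract:
  assumes "finite_graph G" "X \<subseteq> verts G" "odd (card X)" "x \<in> X" "even (card (verts G))"
  shows "even (card (verts (contract G X x)))"
    and "card X \<noteq> 1 \<Longrightarrow> card (verts (contract G X x)) < card (verts G)"
proof -
  have fin: "finite (verts G)" "finite X"
    using finite_graphD(1)[OF assms(1)] finite_subset[OF assms(2)] by simp_all
  then have "card (verts G) = card X + card (verts G - X)"
    using card_Int_Diff[of "verts G" X] assms(2) by (simp add: Int_absorb1)
  moreover have "card (verts (contract G X x)) = Suc (card (verts G - X))"
    using fin assms(4) by (simp add: contract_def)
  moreover have "card X \<noteq> 0" using assms(3) by (intro notI) simp
  ultimately show "even (card (verts (contract G X x)))"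
    "card X \<noteq> 1 \<Longrightarrow> card (verts (contract G X x)) < card (verts G)"
    using assms(3,5) by auto
qed

lemma perfect_matching_contract_cut:
  assumes "finite_graph G" "X \<subseteq> verts G" "x \<in> X" "perfect_matching (contract G X x) M"
  obtains e where "M \<inter> edge_cut G X = {e}"
proof -
  have "card (M \<inter> incident_edges (contract G X x) x) = 1"
    using assms perfect_matching_iff[OF finite_graph_contract[OF assms(1-3)]]
    by (auto simp: contract_def)
  then show thesis
    using that incident_edges_contract(1)[OF assms(1,3)] by (auto simp: card_1_singleton_iff)
qed

text \<open>\<open>M\<close> covers the vertices outside \<open>X\<close> and \<open>N\<close> those
  inside. An edge of one matching that reaches the other shore is a cut edge, hence
  \<open>e\<close>, which lies in both.\<close>

lemma perfect_matching_Un_contract: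
  assumes G: "finite_graph G" and X: "X \<subseteq> verts G" "x \<in> X" "x' \<in> verts G - X"
    and M: "perfect_matching (contract G X x) M" "M \<inter> edge_cut G X = {e}"
    and N: "perfect_matching (contract G (verts G - X) x') N" "N \<inter> edge_cut G X = {e}"
  shows "perfect_matching G (M \<union> N)" "M \<inter> N = {e}"
proof -
  have M': "M \<subseteq> {e \<in> edges G. \<not> ends G e \<subseteq> X}"
    "\<And>v. v \<in> verts G - X \<Longrightarrow> card (M \<inter> incident_edges G v) = 1"
    using M(1) perfect_matching_iff[OF finite_graph_contract[OF G X(1,2)]]
      incident_edges_contract(2)[OF G X(2)] by (auto simp: contract_def)
  have N': "N \<subseteq> {e \<in> edges G. \<not> ends G e \<subseteq> verts G - X}"
    "\<And>v. v \<in> X \<Longrightarrow> card (N \<inter> incident_edges G v) = 1"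
    using N(1) X perfect_matching_iff[OF finite_graph_contract[OF G _ X(3)]]
      incident_edges_contract(2)[OF G X(3)] by (auto simp: contract_def)
  have cut: "f \<in> edge_cut G X"
    if "f \<in> edges G" "\<not> ends G f \<subseteq> X" "\<not> ends G f \<subseteq> verts G - X" for f
    using that edge_cut_iff[OF G that(1)] finite_graphD(5)[OF G that(1)] by auto
  have "M \<inter> N \<subseteq> edge_cut G X" using M'(1) N'(1) cut by auto
  then show "M \<inter> N = {e}" using M(2) N(2) by blast
  have "card ((M \<union> N) \<inter> incident_edges G v) = 1" if v: "v \<in> verts G" for v
  proof (cases "v \<in> X")
    case True
    have "M \<inter> incident_edges G v \<subseteq> edge_cut G X"
      using M'(1) True cut by (auto simp: incident_edges_def)
    then have "(M \<union> N) \<inter> incident_edges G v = N \<inter> incident_edges G v"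
      using M(2) N(2) by blast
    then show ?thesis using N' True by simp
  next
    case False
    have "N \<inter> incident_edges G v \<subseteq> edge_cut G X"
      using N'(1) False cut by (auto simp: incident_edges_def)
    then have "(M \<union> N) \<inter> incident_edges G v = M \<inter> incident_edges G v"
      using M(2) N(2) by blast
    then show ?thesis using M' False v by simp
  qed
  then show "perfect_matching G (M \<union> N)" using perfect_matching_iff[OF G] M' N' by auto
qed

section \<open>Edmonds' theorem\<close>

text \<open>If the edges with \<open>b e < 1\<close> outnumber their ends, counting unknowns gives
  \<open>d\<close>. Otherwise they form a 2-regular graph; one equation is dropped to get a
  solution, and a parity argument recovers that equation after restriction to a suitable set of
  edges.\<close>

lemma incident_edges_kernel_nontrivial:
  fixes G :: "('v, 'e) ugraph"
  assumes G: "finite_graph G" and b: "b \<in> pm_polytope G"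
    and pos: "\<forall>e\<in>edges G. 0 < b e" and frac: "\<exists>e\<in>edges G. b e \<noteq> 1"
  shows "\<exists>d. (\<exists>e\<in>edges G. d e \<noteq> (0 :: real)) \<and> (\<forall>v\<in>verts G. sum d (incident_edges G v) = 0)"
proof -
  note fin = finite_graphD(1,2)[OF G] and ends = finite_graphD(5,6)[OF G]
  let ?inc = "incident_edges G"
  have inc_iff: "e \<in> ?inc v \<longleftrightarrow> e \<in> edges G \<and> v \<in> ends G e" for e v
    by (auto simp: incident_edges_def)
  have deg: "sum b (?inc v) = 1" if "v \<in> verts G" for v
    using b that by (auto simp: pm_polytope_def)
  have two_le: "b e + b f \<le> 1" if ef: "e \<in> ?inc v" "f \<in> ?inc v" "e \<noteq> f" for v e f
  proof -
    have "v \<in> verts G" using ef ends(1) by (auto simp: inc_iff)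
    moreover have "sum b {e, f} \<le> sum b (?inc v)"
      by (rule sum_mono2) (use ef pos finite_graphD(3)[OF G] in \<open>auto simp: inc_iff intro: less_imp_le\<close>)
    ultimately show ?thesis using deg ef by simp
  qed
  have le1: "b e \<le> 1" if e: "e \<in> edges G" for e
  proof -
    obtain v where v: "v \<in> ends G e" using ends(2)[OF e] by fastforce
    have "b e \<le> sum b (?inc v)"
      by (rule member_le_sum) (use e v pos finite_graphD(3)[OF G] in \<open>auto simp: inc_iff intro: less_imp_le\<close>)
    then show ?thesis using deg v ends(1)[OF e] by auto
  qed
  define F where "F = {e \<in> edges G. b e < 1}"
  define U where "U = (\<Union>e\<in>F. ends G e)"
  have F: "F \<subseteq> edges G" "finite F" using fin by (auto simp: F_def)
  have U: "U \<subseteq> verts G" "finite U"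
    using ends(1) fin(1) F by (auto simp: U_def intro: finite_subset)
  have "F \<noteq> {}" using frac le1 by (force simp: F_def)
  have "U \<noteq> {}"
  proof -
    obtain e where "e \<in> F" using \<open>F \<noteq> {}\<close> by auto
    moreover have "ends G e \<noteq> {}" using ends(2)[of e] F calculation by auto
    ultimately show ?thesis by (auto simp: U_def)
  qed
  \<comment> \<open>Another edge at \<open>v\<close> of weight 1 would push the sum at
    \<open>v\<close> above 1, and a single edge of weight below 1 could not reach 1.\<close>
  have U_inc: "?inc v \<subseteq> F" "2 \<le> card (?inc v)" if v: "v \<in> U" for v
  proof -
    obtain e where e: "e \<in> F" "e \<in> ?inc v" using v F by (auto simp: U_def inc_iff)
    show "?inc v \<subseteq> F"
    proof
      fix f assume f: "f \<in> ?inc v"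
      show "f \<in> F"
      proof (cases "f = e")
        case False
        have "b f < 1" using two_le[OF e(2) f] False pos e F by force
        then show ?thesis using f by (auto simp: F_def inc_iff)
      qed (use e in simp)
    qed
    have "?inc v \<noteq> {e}"
      using deg[of v] U v e by (auto simp: F_def)
    then obtain f where "f \<in> ?inc v" "f \<noteq> e" using e by auto
    then have "card {e, f} \<le> card (?inc v)"
      using e finite_graphD(3)[OF G] by (intro card_mono) auto
    then show "2 \<le> card (?inc v)" using \<open>f \<noteq> e\<close> by simp
  qed
  have sum_F: "(\<Sum>e\<in>F. (if v \<in> ends G e then 1 else 0) * d e) = sum d (F \<inter> ?inc v)"
    for v and d :: "'e \<Rightarrow> real"
  proof -
    have "F \<inter> ?inc v = {e \<in> F. v \<in> ends G e}" using F by (auto simp: inc_iff)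
    then show ?thesis using F(2)
      by (simp add: sum.inter_filter if_distrib[of "\<lambda>u. u * _"] cong: if_cong)
  qed
  \<comment> \<open>Extension by zero: edges of \<open>T\<close> have their ends in
    \<open>U\<close>, so only the equations at \<open>U\<close> matter.\<close>
  have kernelI: ?thesis
    if T: "T \<subseteq> F" "e \<in> T" "d e \<noteq> 0" and d: "\<And>v. v \<in> U \<Longrightarrow> sum d (T \<inter> ?inc v) = 0"
    for T e and d :: "'e \<Rightarrow> real"
  proof (intro exI[of _ "\<lambda>e. if e \<in> T then d e else 0"] conjI ballI)
    show "\<exists>e\<in>edges G. (if e \<in> T then d e else 0) \<noteq> 0" using T F by auto
    fix v assume "v \<in> verts G"
    have "(\<Sum>e\<in>?inc v. if e \<in> T then d e else 0) = sum d (T \<inter> ?inc v)"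
      using finite_graphD(3)[OF G] by (simp add: sum.If_cases Int_commute)
    also have "\<dots> = 0"
    proof (cases "v \<in> U")
      case False
      then have "T \<inter> ?inc v = {}" using T by (auto simp: U_def inc_iff)
      then show ?thesis by simp
    qed (rule d)
    finally show "(\<Sum>e\<in>?inc v. if e \<in> T then d e else 0) = 0" .
  qed
  show ?thesis
  proof (cases "card U < card F")
    case True
    from homogeneous_system_nontrivial_solution[OF U(2) F(2) True,
        of "\<lambda>v e. if v \<in> ends G e then 1 else 0"]
    obtain d :: "'e \<Rightarrow> real" and e where "e \<in> F" "d e \<noteq> 0" "\<forall>v\<in>U. sum d (F \<inter> ?inc v) = 0"
      unfolding sum_F by blast
    then show ?thesis using kernelI[of F e d] by auto
  next
    case False
    have degsum: "(\<Sum>v\<in>A. card (T \<inter> ?inc v)) = 2 * card T"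
      if "T \<subseteq> F" "(\<Union>e\<in>T. ends G e) \<subseteq> A" "finite A" for T A
    proof -
      have "(\<Sum>v\<in>A. card (T \<inter> ?inc v)) = (\<Sum>e\<in>T. card (ends G e \<inter> A))"
        by (rule sum_card_incident_edges) (use that F finite_subset in auto)
      also have "\<dots> = (\<Sum>e\<in>T. 2)"
      proof (rule sum.cong[OF refl])
        fix e assume "e \<in> T"
        then have "ends G e \<inter> A = ends G e" "e \<in> edges G" using that F by auto
        then show "card (ends G e \<inter> A) = 2" using ends(2) by simp
      qed
      finally show ?thesis by simp
    qed
    have F_Int: "F \<inter> ?inc v = ?inc v" if "v \<in> U" for v using U_inc(1)[OF that] by auto
    \<comment> \<open>The degree sum \<open>2 * card F\<close> is at most \<open>2 * card U\<close>,
      so no degree exceeds the minimum 2.\<close>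
    have card2: "card (?inc v) = 2" if v: "v \<in> U" for v
    proof (rule ccontr)
      assume "card (?inc v) \<noteq> 2"
      then have "(\<Sum>v\<in>U. 2) < (\<Sum>v\<in>U. card (?inc v))"
        using U_inc(2) v U(2) by (intro sum_strict_mono_ex1) (auto intro!: bexI[of _ v] simp: order_less_le)
      also have "\<dots> = (\<Sum>v\<in>U. card (F \<inter> ?inc v))" using F_Int by simp
      also have "\<dots> = 2 * card F" using degsum[of F U] U by (simp add: U_def)
      finally show False using False by simp
    qed
    \<comment> \<open>Now \<open>card U = card F\<close>, one equation too many for the counting
      argument; the one at \<open>v0\<close> is given up.\<close>
    obtain v0 where v0: "v0 \<in> U" using \<open>U \<noteq> {}\<close> by auto
    have "2 * card F = (\<Sum>v\<in>U. card (F \<inter> ?inc v))" using degsum[of F U] U by (simp add: U_def)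
    also have "\<dots> = 2 * card U" using F_Int card2 by simp
    finally have "card (U - {v0}) < card F" "finite (U - {v0})"
      using card_Diff1_less[OF U(2) v0] U(2) by auto
    from homogeneous_system_nontrivial_solution[OF this(2) F(2) this(1),
        of "\<lambda>v e. if v \<in> ends G e then 1 else 0"]
    obtain d :: "'e \<Rightarrow> real" and e0 where e0: "e0 \<in> F" "d e0 \<noteq> 0" and "\<forall>v\<in>U - {v0}. sum d (F \<inter> ?inc v) = 0"
      unfolding sum_F by blast
    then have d: "sum d (?inc v) = 0" if "v \<in> U" "v \<noteq> v0" for v using that F_Int by auto
    define t where "t = \<bar>d e0\<bar>"
    \<comment> \<open>At a vertex other than \<open>v0\<close> the two values of \<open>d\<close>
      cancel, so their absolute values agree and \<open>T\<close> is closed there. On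
      \<open>T\<close> all values of \<open>d\<close> are \<open>t\<close> or
      \<open>- t\<close>.\<close>
    define T where "T = {e \<in> F. \<bar>d e\<bar> = t}"
    define A where "A = (\<Union>e\<in>T. ends G e)"
    have t: "t > 0" using e0 by (simp add: t_def)
    have T: "T \<subseteq> F" "e0 \<in> T" "finite T" using e0 F by (auto simp: T_def t_def)
    have A: "A \<subseteq> U" using T(1) by (auto simp: A_def U_def)
    then have finA: "finite A" using U(2) by (rule finite_subset)
    have closed: "?inc v \<subseteq> T" if v: "v \<in> U" "v \<noteq> v0" and meet: "T \<inter> ?inc v \<noteq> {}" for v
    proof -
      obtain e f where ef: "?inc v = {e, f}" "e \<noteq> f" using card2[OF v(1)] by (meson card_2_iff)
      then have "\<bar>d e\<bar> = \<bar>d f\<bar>" using d[OF v] by simp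
      then show ?thesis using U_inc(1)[OF v(1)] meet ef by (auto simp: T_def)
    qed
    \<comment> \<open>The equation at \<open>v0\<close> was dropped, but the handshake lemma for \<open>T\<close> forces an even
      number of edges of \<open>T\<close> at \<open>v0\<close> as well.\<close>
    have closed0: "?inc v0 \<subseteq> T" if "T \<inter> ?inc v0 \<noteq> {}"
    proof -
      have "even (card (T \<inter> ?inc v))" if "v \<in> U - {v0}" for v
      proof (cases "T \<inter> ?inc v = {}")
        case False
        then have "T \<inter> ?inc v = ?inc v" using closed that by auto
        then show ?thesis using card2 that by simp
      qed simp
      then have "even (\<Sum>v\<in>U - {v0}. card (T \<inter> ?inc v))" by (rule dvd_sum)
      moreover have "(\<Sum>v\<in>U. card (T \<inter> ?inc v)) = 2 * card T"
        using degsum[OF T(1)] A U by (simp add: A_def)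
      ultimately have "even (card (T \<inter> ?inc v0))"
        using sum.remove[OF U(2) v0, of "\<lambda>v. card (T \<inter> ?inc v)"] by presburger
      moreover have "card (T \<inter> ?inc v0) \<noteq> 0" using that T(3) by simp
      moreover have "card (T \<inter> ?inc v0) \<le> card (?inc v0)"
        by (rule card_mono) (use finite_graphD(3)[OF G] in auto)
      ultimately have "card (T \<inter> ?inc v0) = card (?inc v0)"
        using card2[OF v0] by presburger
      then have "T \<inter> ?inc v0 = ?inc v0"
        using finite_graphD(3)[OF G] by (intro card_subset_eq) auto
      then show ?thesis by auto
    qed
    have A_inc: "?inc v \<subseteq> T" if v: "v \<in> A" for v
    proof -
      obtain e where "e \<in> T" "v \<in> ends G e" using v by (auto simp: A_def)
      then have "e \<in> T \<inter> ?inc v" using T(1) F(1) by (auto simp: inc_iff)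
      then have "T \<inter> ?inc v \<noteq> {}" by blast
      then show ?thesis using closed[of v] closed0 A v by auto
    qed
    \<comment> \<open>Every edge at a vertex of \<open>A\<close> lies in \<open>T\<close> and has
      both ends in \<open>A\<close>. An odd \<open>A\<close> would thus violate its cut constraint,
      which would read \<open>1 \<le> 0\<close>.\<close>
    have "edge_cut G A = {}"
    proof (rule ccontr)
      assume "edge_cut G A \<noteq> {}"
      then obtain e where e: "e \<in> edge_cut G A" "e \<in> edges G" by (auto simp: edge_cut_def)
      then obtain v where "v \<in> ends G e" "v \<in> A" "\<not> ends G e \<subseteq> A"
        using edge_cut_iff[OF G e(2)] by auto
      then show False using A_inc[of v] e by (auto simp: A_def inc_iff)
    qed
    then have "\<not> 1 \<le> sum b (edge_cut G A)" by simp
    moreover have "A \<subseteq> verts G" using A U(1) by (rule subset_trans)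
    ultimately have "even (card A)" using b unfolding pm_polytope_def by blast
    moreover have "card A = card T"
    proof -
      have "2 * card T = (\<Sum>v\<in>A. card (T \<inter> ?inc v))"
        using degsum[OF T(1) _ finA] by (simp add: A_def)
      also have "\<dots> = (\<Sum>v\<in>A. 2)"
        by (rule sum.cong) (use A_inc A card2 in \<open>auto simp: Int_absorb1\<close>)
      finally show ?thesis by simp
    qed
    ultimately have evenT: "even (card T)" by simp
    \<comment> \<open>Summing over the vertices of \<open>A\<close> counts each edge of
      \<open>T\<close> twice, and only \<open>v0\<close> contributes: its sum is
      \<open>2 * t * k\<close>. This is at most \<open>2 * t\<close> in absolute value, while
      \<open>k\<close> has the parity of \<open>card T\<close>, which is even; so
      \<open>k = 0\<close>.\<close>
    have "sum d (T \<inter> ?inc v0) = 0"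
    proof (cases "v0 \<in> A")
      case False
      then have "T \<inter> ?inc v0 = {}" by (auto simp: A_def inc_iff)
      then show ?thesis by simp
    next
      case True
      define P where "P = {e \<in> T. d e = t}"
      define k where "k = int (card P) - int (card (T - P))"
      have sumT: "sum d T = t * of_int k"
      proof -
        have "sum d T = sum d P + sum d (T - P)"
          using sum.subset_diff[of P T d] T(3) by (simp add: P_def)
        moreover have "sum d P = (\<Sum>e\<in>P. t)" by (rule sum.cong) (auto simp: P_def)
        moreover have "sum d (T - P) = (\<Sum>e\<in>T - P. - t)"
          by (rule sum.cong) (auto simp: P_def T_def)
        ultimately show ?thesis by (simp add: k_def algebra_simps)
      qed
      have "card T = card P + card (T - P)"
        using card_Int_Diff[OF T(3), of P] by (simp add: P_def Int_def)
      then have evenk: "even k" using evenT by (auto simp: k_def)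
      have "(\<Sum>v\<in>A. sum d (T \<inter> ?inc v)) = (\<Sum>e\<in>T. of_nat (card (ends G e \<inter> A)) * d e)"
        by (rule sum_incident_edges) (use finA T F in auto)
      also have "\<dots> = (\<Sum>e\<in>T. 2 * d e)"
      proof (rule sum.cong[OF refl])
        fix e assume "e \<in> T"
        then have "ends G e \<inter> A = ends G e" "e \<in> edges G" using T F by (auto simp: A_def)
        then show "of_nat (card (ends G e \<inter> A)) * d e = 2 * d e" using ends(2) by simp
      qed
      finally have "(\<Sum>v\<in>A. sum d (T \<inter> ?inc v)) = 2 * t * of_int k"
        by (simp add: sum_distrib_left[symmetric] sumT)
      moreover have "(\<Sum>v\<in>A. sum d (T \<inter> ?inc v)) = sum d (?inc v0)"
      proof -
        have "(\<Sum>v\<in>A. sum d (T \<inter> ?inc v)) = (\<Sum>v\<in>A. sum d (?inc v))"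
          by (rule sum.cong) (use A_inc in \<open>auto simp: Int_absorb1\<close>)
        also have "\<dots> = sum d (?inc v0) + (\<Sum>v\<in>A - {v0}. sum d (?inc v))"
          by (rule sum.remove[OF finA True])
        also have "(\<Sum>v\<in>A - {v0}. sum d (?inc v)) = 0"
          by (rule sum.neutral) (use d A in auto)
        finally show ?thesis by simp
      qed
      moreover have "\<bar>sum d (?inc v0)\<bar> \<le> 2 * t"
      proof -
        have "\<bar>sum d (?inc v0)\<bar> \<le> (\<Sum>e\<in>?inc v0. \<bar>d e\<bar>)" by (rule sum_abs)
        also have "\<dots> = (\<Sum>e\<in>?inc v0. t)"
          by (rule sum.cong) (use A_inc[OF True] in \<open>auto simp: T_def\<close>)
        finally show ?thesis using card2[OF v0] by simp
      qed
      ultimately have "\<bar>real_of_int k\<bar> \<le> 1" using t by (simp add: abs_mult)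
      then have "k = 0" using evenk by (cases "k = 0") auto
      moreover have "T \<inter> ?inc v0 = ?inc v0" using A_inc[OF True] by auto
      ultimately show ?thesis
        using \<open>_ = 2 * t * of_int k\<close> \<open>_ = sum d (?inc v0)\<close> by simp
    qed
    moreover have "sum d (T \<inter> ?inc v) = 0" if v: "v \<in> U" "v \<noteq> v0" for v
    proof (cases "T \<inter> ?inc v = {}")
      case False
      then have "T \<inter> ?inc v = ?inc v" using closed v by auto
      then show ?thesis using d v by simp
    qed simp
    ultimately show ?thesis using kernelI[of T e0 d] T e0 by metis
  qed
qed

text \<open>
  By linear programming duality, \<open>dominates_pm G b\<close> says that \<open>b\<close> lies in the convex hull of the
  incidence vectors of the perfect matchings. In this dual form the two halves of a tight cut can
  be glued without handling convex combinations.
\<close>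

definition dominates_pm :: "('v, 'e) ugraph \<Rightarrow> ('e \<Rightarrow> real) \<Rightarrow> bool" where
  "dominates_pm G b \<longleftrightarrow>
     (\<forall>w :: 'e \<Rightarrow> real. \<exists>M. perfect_matching G M \<and> sum w M \<le> (\<Sum>e\<in>edges G. w e * b e))"

text \<open>For a cut edge \<open>e\<close> let \<open>c e\<close> be the least weight of a perfect
  matching through \<open>e\<close> in the second contraction. A matching of the first contraction,
  found with the cut edges priced at \<open>c\<close>, is completed by an optimal one on the other
  side.\<close>

lemma dominates_pm_contract:
  fixes G :: "('v, 'e) ugraph"
  assumes G: "finite_graph G" and X: "X \<subseteq> verts G" "x \<in> X" "x' \<in> verts G - X"
    and pos: "\<forall>e\<in>edges G. 0 < b e"
    and dom1: "dominates_pm (contract G X x) b"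
    and dom2: "dominates_pm (contract G (verts G - X) x') b"
  shows "dominates_pm G b"
  unfolding dominates_pm_def
proof
  fix w :: "'e \<Rightarrow> real"
  let ?G1 = "contract G X x" and ?G2 = "contract G (verts G - X) x'" and ?C = "edge_cut G X"
  have fin1: "finite_graph ?G1" and fin2: "finite_graph ?G2"
    using finite_graph_contract[OF G] X by auto
  have E1: "e \<in> edges ?G1 \<longleftrightarrow> e \<in> edges G \<and> \<not> ends G e \<subseteq> X"
    and E2: "e \<in> edges ?G2 \<longleftrightarrow> e \<in> edges G \<and> \<not> ends G e \<subseteq> verts G - X" for e
    by (auto simp: contract_def)
  have finE: "finite (edges ?G1)" "finite (edges ?G2)" using finite_graphD(2) fin1 fin2 by auto
  have C_iff: "e \<in> ?C \<longleftrightarrow> e \<in> edges ?G1 \<and> e \<in> edges ?G2" for e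
  proof (cases "e \<in> edges G")
    case True
    then show ?thesis using edge_cut_iff[OF G True, of X] finite_graphD(5)[OF G True] E1 E2 by auto
  qed (auto simp: E1 E2 edge_cut_def)
  have C: "?C \<subseteq> edges ?G1" "?C \<subseteq> edges ?G2" using C_iff by auto
  have E: "edges G = (edges ?G1 - ?C) \<union> edges ?G2"
  proof -
    have "e \<in> edges ?G1 \<or> e \<in> edges ?G2" if e: "e \<in> edges G" for e
    proof -
      have "ends G e \<noteq> {}" using finite_graphD(6)[OF G e] by auto
      then show ?thesis using e unfolding E1 E2 by blast
    qed
    then show ?thesis using C_iff by (auto simp: E1 E2)
  qed
  have cut1: "\<exists>e. M \<inter> ?C = {e}" if "perfect_matching ?G1 M" for M
    using perfect_matching_contract_cut[OF G X(1,2) that] by metis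
  have cut2: "\<exists>e. N \<inter> ?C = {e}" if "perfect_matching ?G2 N" for N
    using perfect_matching_contract_cut[OF G _ X(3) that] edge_cut_Diff[OF G, of X] by (metis Diff_subset)
  have "\<exists>N. (perfect_matching ?G2 N \<and> e \<in> N) \<and>
      (\<forall>N'. perfect_matching ?G2 N' \<and> e \<in> N' \<longrightarrow> sum w N \<le> sum w N')" if e: "e \<in> ?C" for e
  proof -
    let ?S = "{N. perfect_matching ?G2 N \<and> e \<in> N}"
    have "?S \<subseteq> Pow (edges ?G2)" using perfect_matching_iff[OF fin2] by auto
    then have "finite ?S" using finE(2) by (meson finite_Pow_iff finite_subset)
    moreover have "?S \<noteq> {}"
    proof -
      \<comment> \<open>Weight -1 on \<open>e\<close> and 0 elsewhere: the matching obtained weighs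
        at most \<open>- b e\<close>, which is negative, so it contains \<open>e\<close>.\<close>
      obtain N where N: "perfect_matching ?G2 N"
        "(\<Sum>f\<in>N. - of_bool (f = e)) \<le> (\<Sum>f\<in>edges ?G2. - of_bool (f = e) * b f)"
        using dom2[unfolded dominates_pm_def, rule_format, of "\<lambda>f. - of_bool (f = e)"] by auto
      have "(\<Sum>f\<in>edges ?G2. - of_bool (f = e) * b f) = (\<Sum>f\<in>edges ?G2. if f = e then - b f else 0)"
        by (rule sum.cong) auto
      also have "\<dots> = - b e" using finE(2) C e by (subst sum.delta) auto
      also have "\<dots> < 0" using pos e by (auto simp: edge_cut_def)
      finally have "(\<Sum>f\<in>N. - of_bool (f = e)) < (0 :: real)" using N(2) by linarith
      then have "e \<in> N" by (metis (mono_tags, lifting) less_irrefl neg_equal_0_iff_equal of_bool_eq(1) sum.neutral)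
      then show ?thesis using N(1) by auto
    qed
    ultimately obtain N where "is_arg_min (sum w) (\<lambda>N. N \<in> ?S) N"
      using ex_is_arg_min_if_finite by blast
    then show ?thesis by (auto simp: is_arg_min_linorder)
  qed
  then obtain N where N: "\<And>e. e \<in> ?C \<Longrightarrow> perfect_matching ?G2 (N e)" "\<And>e. e \<in> ?C \<Longrightarrow> e \<in> N e"
    "\<And>e N'. \<lbrakk>e \<in> ?C; perfect_matching ?G2 N'; e \<in> N'\<rbrakk> \<Longrightarrow> sum w (N e) \<le> sum w N'"
    by metis
  define c where "c e = sum w (N e)" for e
  have split: "(\<Sum>e\<in>S. f e - (if e \<in> ?C then g e else 0)) = sum f S - sum g (S \<inter> ?C)"
    if "finite S" for S and f g :: "'e \<Rightarrow> real"
    using that by (simp add: sum_subtractf sum.If_cases)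
  \<comment> \<open>With each cut edge \<open>e\<close> made cheaper by \<open>c e\<close>, every
    perfect matching of \<open>?G2\<close> has nonnegative weight by minimality.\<close>
  have C_le: "(\<Sum>e\<in>?C. c e * b e) \<le> (\<Sum>e\<in>edges ?G2. w e * b e)"
  proof -
    obtain M where M: "perfect_matching ?G2 M"
      "(\<Sum>e\<in>M. w e - (if e \<in> ?C then c e else 0))
        \<le> (\<Sum>e\<in>edges ?G2. (w e - (if e \<in> ?C then c e else 0)) * b e)"
      using dom2[unfolded dominates_pm_def, rule_format,
          of "\<lambda>e. w e - (if e \<in> ?C then c e else 0)"] by auto
    have finM: "finite M" using M(1) perfect_matching_iff[OF fin2] finE finite_subset by auto
    obtain e where e: "M \<inter> ?C = {e}" using cut2[OF M(1)] by auto
    have "0 \<le> sum w M - c e" using N(3)[of e M] M(1) e by (auto simp: c_def)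
    also have "\<dots> = (\<Sum>e\<in>M. w e - (if e \<in> ?C then c e else 0))"
      unfolding split[OF finM] e by simp
    also note M(2)
    also have "(\<Sum>e\<in>edges ?G2. (w e - (if e \<in> ?C then c e else 0)) * b e) =
        (\<Sum>e\<in>edges ?G2. w e * b e - (if e \<in> ?C then c e * b e else 0))"
      by (rule sum.cong) (auto simp: algebra_simps)
    also have "\<dots> = (\<Sum>e\<in>edges ?G2. w e * b e) - (\<Sum>e\<in>?C. c e * b e)"
      unfolding split[OF finE(2)] using C(2) by (simp add: Int_absorb1)
    finally show ?thesis by simp
  qed
  \<comment> \<open>The cut edges get weight \<open>c e\<close>, written as a correction of
    \<open>w e\<close> so that \<open>split\<close> applies.\<close>
  obtain M where M: "perfect_matching ?G1 M"
    "(\<Sum>e\<in>M. w e - (if e \<in> ?C then w e - c e else 0))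
      \<le> (\<Sum>e\<in>edges ?G1. (w e - (if e \<in> ?C then w e - c e else 0)) * b e)"
    using dom1[unfolded dominates_pm_def, rule_format,
        of "\<lambda>e. w e - (if e \<in> ?C then w e - c e else 0)"] by auto
  have finM: "finite M" using M(1) perfect_matching_iff[OF fin1] finE finite_subset by auto
  obtain e where e: "M \<inter> ?C = {e}" using cut1[OF M(1)] by auto
  then have eC: "e \<in> ?C" by auto
  have finN: "finite (N e)"
    using N(1)[OF eC] perfect_matching_iff[OF fin2] finE finite_subset by auto
  have "N e \<inter> ?C = {e}" using cut2[OF N(1)[OF eC]] N(2)[OF eC] eC by (metis IntI singletonD)
  note glue = perfect_matching_Un_contract[OF G X M(1) e N(1)[OF eC] this]
  have "sum w (M \<union> N e) = sum w M - w e + c e"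
    using sum.union_inter[OF finM finN, of w] glue(2) by (simp add: c_def)
  also have "\<dots> = (\<Sum>e\<in>M. w e - (if e \<in> ?C then w e - c e else 0))"
    unfolding split[OF finM] e by simp
  also note M(2)
  also have "(\<Sum>e\<in>edges ?G1. (w e - (if e \<in> ?C then w e - c e else 0)) * b e) =
      (\<Sum>e\<in>edges ?G1. w e * b e - (if e \<in> ?C then w e * b e - c e * b e else 0))"
    by (rule sum.cong) (auto simp: algebra_simps)
  also have "\<dots> = (\<Sum>e\<in>edges ?G1. w e * b e) - (\<Sum>e\<in>?C. w e * b e) + (\<Sum>e\<in>?C. c e * b e)"
    unfolding split[OF finE(1)] using C(1) by (simp add: Int_absorb1 sum_subtractf)
  also have "\<dots> = (\<Sum>e\<in>edges ?G1 - ?C. w e * b e) + (\<Sum>e\<in>?C. c e * b e)"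
    using sum_diff[OF finE(1) C(1), of "\<lambda>e. w e * b e"] by simp
  also have "\<dots> \<le> (\<Sum>e\<in>edges ?G1 - ?C. w e * b e) + (\<Sum>e\<in>edges ?G2. w e * b e)"
    using C_le by simp
  also have "\<dots> = (\<Sum>e\<in>edges G. w e * b e)"
    unfolding E using finE C_iff by (intro sum.union_disjoint[symmetric]) auto
  finally show "\<exists>M. perfect_matching G M \<and> sum w M \<le> (\<Sum>e\<in>edges G. w e * b e)"
    using glue(1) by blast
qed

section \<open>Edge deletion and motion inside the polytope\<close>

lemma dominates_pm_delete_edge:
  fixes G :: "('v, 'e) ugraph"
  assumes G: "finite_graph G" and e: "e \<in> edges G" "b e = 0"
    and dom: "dominates_pm (G\<lparr>edges := edges G - {e}\<rparr>) b"
  shows "dominates_pm G b"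
  unfolding dominates_pm_def
proof
  fix w :: "'e \<Rightarrow> real"
  obtain M where M: "perfect_matching (G\<lparr>edges := edges G - {e}\<rparr>) M"
    "sum w M \<le> (\<Sum>f\<in>edges G - {e}. w f * b f)"
    using dom by (auto simp: dominates_pm_def)
  have "(\<Sum>f\<in>edges G - {e}. w f * b f) = (\<Sum>f\<in>edges G. w f * b f)"
    using sum.remove[OF finite_graphD(2)[OF G] e(1), of "\<lambda>f. w f * b f"] e(2) by simp
  moreover have "perfect_matching G M"
    using M(1) by (auto simp: perfect_matching_def matching_def)
  ultimately show "\<exists>M. perfect_matching G M \<and> sum w M \<le> (\<Sum>e\<in>edges G. w e * b e)"
    using M(2) by auto
qed

lemma pm_polytope_delete_edge:
  assumes G: "finite_graph G" and e: "e \<in> edges G" "b e = 0" and b: "b \<in> pm_polytope G"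
  shows "finite_graph (G\<lparr>edges := edges G - {e}\<rparr>)" "b \<in> pm_polytope (G\<lparr>edges := edges G - {e}\<rparr>)"
proof -
  let ?H = "G\<lparr>edges := edges G - {e}\<rparr>"
  show "finite_graph ?H" using G by (auto simp: finite_graph_def)
  have "edge_cut ?H X = edge_cut G X - {e}" "incident_edges ?H v = incident_edges G v - {e}" for X v
    by (auto simp: edge_cut_def incident_edges_def)
  moreover have "sum b (A - {e}) = sum b A" if "finite A" for A
    using that e(2) by (simp add: sum_diff1)
  ultimately show "b \<in> pm_polytope ?H"
    using b finite_graphD(3,4)[OF G] by (auto simp: pm_polytope_def)
qed

text \<open>The degree equations hold along the whole ray, so only edge bounds and nontrivial odd
  cuts can stop it. All of these start with positive slack, and the ratio test finds the first to
  become tight.\<close>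

lemma pm_polytope_perturb:
  fixes G :: "('v, 'e) ugraph"
  assumes G: "finite_graph G" and b: "b \<in> pm_polytope G" and pos: "\<forall>e\<in>edges G. 0 < b e"
    and slack: "\<And>X. \<lbrakk>X \<subseteq> verts G; odd (card X); card X \<noteq> 1; card (verts G - X) \<noteq> 1\<rbrakk>
      \<Longrightarrow> 1 < sum b (edge_cut G X)"
    and d: "\<exists>e\<in>edges G. d e \<noteq> 0" "\<forall>v\<in>verts G. sum d (incident_edges G v) = 0"
  obtains t where "0 \<le> t" "(\<lambda>e. b e + t * d e) \<in> pm_polytope G"
    "(\<exists>e\<in>edges G. b e + t * d e = 0) \<or>
     (\<exists>X\<subseteq>verts G. odd (card X) \<and> card X \<noteq> 1 \<and> card (verts G - X) \<noteq> 1 \<and>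
        (\<Sum>e\<in>edge_cut G X. b e + t * d e) = 1)"
proof -
  define \<X> where "\<X> = {X. X \<subseteq> verts G \<and> odd (card X) \<and> card X \<noteq> 1 \<and> card (verts G - X) \<noteq> 1}"
  have "finite \<X>" using finite_graphD(1)[OF G] by (simp add: \<X>_def)
  define R where "R = (\<lambda>e. (b e, d e)) ` edges G \<union>
    (\<lambda>X. (sum b (edge_cut G X) - 1, sum d (edge_cut G X))) ` \<X>"
  \<comment> \<open>A nonzero \<open>d\<close> with vanishing vertex sums has a negative entry, so
    the ray does leave the polytope.\<close>
  have "\<exists>e\<in>edges G. d e < 0"
  proof (rule ccontr)
    assume "\<not> ?thesis"
    then have nonneg: "\<forall>e\<in>edges G. 0 \<le> d e" by (simp add: not_less)
    obtain e where e: "e \<in> edges G" "d e \<noteq> 0" using d(1) by auto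
    have "ends G e \<noteq> {}" using finite_graphD(6)[OF G e(1)] by auto
    then obtain v where v: "v \<in> ends G e" by auto
    have "d e \<le> sum d (incident_edges G v)"
      by (rule member_le_sum)
        (use e v nonneg finite_graphD(3)[OF G] in \<open>auto simp: incident_edges_def\<close>)
    then show False using d(2) v finite_graphD(5)[OF G e(1)] nonneg e by force
  qed
  then obtain e where e: "e \<in> edges G" "d e < 0" by auto
  have "finite R" using \<open>finite \<X>\<close> finite_graphD(2)[OF G] by (simp add: R_def)
  moreover have "0 < s" if "(s, r) \<in> R" for s r
    using that pos slack by (auto simp: R_def \<X>_def)
  moreover have "(b e, d e) \<in> R" using e by (auto simp: R_def)
  ultimately obtain t s r where t: "0 \<le> t" "\<And>s r. (s, r) \<in> R \<Longrightarrow> 0 \<le> s + t * r"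
    and sr: "(s, r) \<in> R" "s + t * r = 0"
    using e(2) first_vanishing_constraint[of R "b e" "d e"] by metis
  have sum_bd: "(\<Sum>e\<in>A. b e + t * d e) = sum b A + t * sum d A" for A
    by (simp add: sum.distrib sum_distrib_left)
  have deg: "(\<Sum>e\<in>incident_edges G v. b e + t * d e) = 1" if "v \<in> verts G" for v
    using b d(2) that by (simp add: sum_bd pm_polytope_def)
  have triv: "(\<Sum>e\<in>edge_cut G X. b e + t * d e) = 1" if "X \<subseteq> verts G" "card X = 1" for X
    using that deg by (auto simp: card_1_singleton_iff edge_cut_singleton)
  have "1 \<le> (\<Sum>e\<in>edge_cut G X. b e + t * d e)" if X: "X \<subseteq> verts G" "odd (card X)" for X
  proof -
    consider "card X = 1" | "card (verts G - X) = 1" | "X \<in> \<X>" using X by (auto simp: \<X>_def)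
    then show ?thesis
    proof cases
      case 1
      then show ?thesis using triv X by simp
    next
      case 2
      then show ?thesis using triv[of "verts G - X"] edge_cut_Diff[OF G, of X] by simp
    next
      case 3
      then have "0 \<le> (sum b (edge_cut G X) - 1) + t * sum d (edge_cut G X)"
        by (intro t(2)) (auto simp: R_def)
      then show ?thesis by (simp add: sum_bd)
    qed
  qed
  moreover have "0 \<le> b e + t * d e" if "e \<in> edges G" for e
    using t(2)[of "b e" "d e"] that by (auto simp: R_def)
  ultimately have "(\<lambda>e. b e + t * d e) \<in> pm_polytope G" using deg by (auto simp: pm_polytope_def)
  moreover have "(\<exists>e\<in>edges G. b e + t * d e = 0) \<or> (\<exists>X\<in>\<X>. (\<Sum>e\<in>edge_cut G X. b e + t * d e) = 1)"
    using sr by (auto simp: R_def sum_bd algebra_simps)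
  ultimately show thesis using that[of t] t(1) unfolding \<X>_def by auto
qed

text \<open>Edge deletion and contraction of a nontrivial odd shore both decrease the number of
  vertices plus edges. A fractional \<open>b\<close> without tight constraints is first moved until
  one becomes tight.\<close>

theorem pm_polytope_dominates_pm:
  fixes G :: "('v, 'e) ugraph"
  assumes "finite_graph G" "even (card (verts G))" "b \<in> pm_polytope G"
  shows "dominates_pm G b"
  using assms
proof (induction "card (verts G) + card (edges G)" arbitrary: G b rule: less_induct)
  case less
  note G = less.prems(1) and even = less.prems(2)
  \<comment> \<open>Stated for any \<open>b'\<close>, to serve both \<open>b\<close> itself and the
    moved point.\<close>
  have reduce: "dominates_pm G b'"
    if b': "b' \<in> pm_polytope G"
      and tight: "(\<exists>e\<in>edges G. b' e = 0) \<or> (\<exists>X\<subseteq>verts G. odd (card X) \<and> card X \<noteq> 1 \<and>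
        card (verts G - X) \<noteq> 1 \<and> sum b' (edge_cut G X) = 1)" for b'
  proof (cases "\<exists>e\<in>edges G. b' e = 0")
    case True
    then obtain e where e: "e \<in> edges G" "b' e = 0" by auto
    let ?H = "G\<lparr>edges := edges G - {e}\<rparr>"
    have "card (edges ?H) < card (edges G)"
      using card_Diff1_less[OF finite_graphD(2)[OF G] e(1)] by simp
    then have "dominates_pm ?H b'"
      using pm_polytope_delete_edge[OF G e b'] even by (intro less.hyps) auto
    then show ?thesis by (rule dominates_pm_delete_edge[where e = e and b = b', OF G e])
  next
    case False
    then obtain X where X: "X \<subseteq> verts G" "odd (card X)" "card X \<noteq> 1" "card (verts G - X) \<noteq> 1"
      "sum b' (edge_cut G X) = 1" using tight by auto
    have pos: "\<forall>e\<in>edges G. 0 < b' e" using False b' by (force simp: pm_polytope_def)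
    have "card (verts G) = card X + card (verts G - X)"
      using card_Int_Diff[OF finite_graphD(1)[OF G], of X] X(1) by (simp add: Int_absorb1)
    then have odd': "odd (card (verts G - X))" using X(2) even by presburger
    have hull: "dominates_pm (contract G Y y) b'"
      if Y: "Y \<subseteq> verts G" "odd (card Y)" "y \<in> Y" "card Y \<noteq> 1" "sum b' (edge_cut G Y) = 1" for Y y
    proof (rule less.hyps)
      show "finite_graph (contract G Y y)" using finite_graph_contract G Y by auto
      show "even (card (verts (contract G Y y)))"
        using even_card_verts_contract(1)[OF G Y(1-3) even] .
      show "b' \<in> pm_polytope (contract G Y y)" using pm_polytope_contract[OF G Y(1-3) b' Y(5)] .
      have "card (edges (contract G Y y)) \<le> card (edges G)"
        using finite_graphD(2)[OF G] by (intro card_mono) (auto simp: contract_def)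
      then show "card (verts (contract G Y y)) + card (edges (contract G Y y))
          < card (verts G) + card (edges G)"
        using even_card_verts_contract(2)[OF G Y(1-3) even Y(4)] by simp
    qed
    have "X \<noteq> {}" "verts G - X \<noteq> {}" using X(2) odd' by (metis card.empty even_zero)+
    then obtain x x' where x: "x \<in> X" "x' \<in> verts G - X" by blast
    show ?thesis
      using dominates_pm_contract[OF G X(1) x pos hull[OF X(1,2) x(1) X(3,5)]]
        hull[OF Diff_subset odd' x(2) X(4)] X(5) edge_cut_Diff[OF G, of X] by simp
  qed
  show ?case
  proof (cases "(\<exists>e\<in>edges G. b e = 0) \<or> (\<exists>X\<subseteq>verts G. odd (card X) \<and> card X \<noteq> 1 \<and>
        card (verts G - X) \<noteq> 1 \<and> sum b (edge_cut G X) = 1)")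
    case True
    then show ?thesis by (rule reduce[OF less.prems(3)])
  next
    case False
    have pos: "\<forall>e\<in>edges G. 0 < b e"
      using False less.prems(3) by (force simp: pm_polytope_def)
    have slack: "1 < sum b (edge_cut G X)"
      if "X \<subseteq> verts G" "odd (card X)" "card X \<noteq> 1" "card (verts G - X) \<noteq> 1" for X
    proof -
      have "1 \<le> sum b (edge_cut G X)" using less.prems(3) that by (auto simp: pm_polytope_def)
      moreover have "sum b (edge_cut G X) \<noteq> 1" using False that by blast
      ultimately show ?thesis by simp
    qed
    show ?thesis
    proof (cases "\<exists>e\<in>edges G. b e \<noteq> 1")
      \<comment> \<open>With all weights 1, the degree equations make the whole edge set a perfect
        matching.\<close>
      case False
      have "card (edges G \<inter> incident_edges G v) = 1" if v: "v \<in> verts G" for v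
      proof -
        have inc: "edges G \<inter> incident_edges G v = incident_edges G v"
          by (auto simp: incident_edges_def)
        have "sum b (incident_edges G v) = (\<Sum>e\<in>incident_edges G v. 1)"
          by (rule sum.cong) (use False in \<open>auto simp: incident_edges_def\<close>)
        then show ?thesis using less.prems(3) v by (simp add: inc pm_polytope_def)
      qed
      then have "perfect_matching G (edges G)" using perfect_matching_iff[OF G] by auto
      moreover have "(\<Sum>e\<in>edges G. w e * b e) = sum w (edges G)" for w
        by (rule sum.cong) (use False in auto)
      ultimately show ?thesis unfolding dominates_pm_def by (metis order_refl)
    next
      case True
      from incident_edges_kernel_nontrivial[OF G less.prems(3) pos True]
      obtain d where d: "\<exists>e\<in>edges G. d e \<noteq> (0 :: real)"
        "\<forall>v\<in>verts G. sum d (incident_edges G v) = 0" by blast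
      show ?thesis unfolding dominates_pm_def
      proof
        fix w :: "'e \<Rightarrow> real"
        \<comment> \<open>Both \<open>d\<close> and its negative satisfy the homogeneous equations;
          the sign is chosen so that moving along \<open>s * d\<close> does not increase the
          weight.\<close>
        define s :: real where "s = (if (\<Sum>e\<in>edges G. w e * d e) \<le> 0 then 1 else - 1)"
        have sd: "\<exists>e\<in>edges G. s * d e \<noteq> 0"
          "\<forall>v\<in>verts G. (\<Sum>e\<in>incident_edges G v. s * d e) = 0"
          using d by (auto simp: s_def sum_distrib_left[symmetric])
        have wsd: "(\<Sum>e\<in>edges G. w e * (s * d e)) \<le> 0"
          by (simp add: s_def sum_negf)
        obtain t where t: "0 \<le> t" "(\<lambda>e. b e + t * (s * d e)) \<in> pm_polytope G"
          "(\<exists>e\<in>edges G. b e + t * (s * d e) = 0) \<or> (\<exists>X\<subseteq>verts G. odd (card X) \<and>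
             card X \<noteq> 1 \<and> card (verts G - X) \<noteq> 1 \<and>
             (\<Sum>e\<in>edge_cut G X. b e + t * (s * d e)) = 1)"
          by (rule pm_polytope_perturb[OF G less.prems(3) pos slack sd])
        then obtain M where M: "perfect_matching G M"
          "sum w M \<le> (\<Sum>e\<in>edges G. w e * (b e + t * (s * d e)))"
          using reduce[OF t(2,3)] unfolding dominates_pm_def by blast
        note M(2)
        also have "(\<Sum>e\<in>edges G. w e * (b e + t * (s * d e))) =
            (\<Sum>e\<in>edges G. w e * b e) + t * (\<Sum>e\<in>edges G. w e * (s * d e))"
          by (simp add: distrib_left sum.distrib sum_distrib_left mult.left_commute)
        also have "\<dots> \<le> (\<Sum>e\<in>edges G. w e * b e)"
          using t(1) wsd by (simp add: mult_nonneg_nonpos)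
        finally show "\<exists>M. perfect_matching G M \<and> sum w M \<le> (\<Sum>e\<in>edges G. w e * b e)"
          using M(1) by blast
      qed
    qed
  qed
qed

section \<open>Duality\<close>

lemma pm_polytope_convex:
  assumes "p \<in> pm_polytope G" "q \<in> pm_polytope G" "0 \<le> t" "t \<le> 1"
  shows "(\<lambda>e. (1 - t) * p e + t * q e) \<in> pm_polytope G"
proof -
  have "(\<Sum>e\<in>A. (1 - t) * p e + t * q e) = (1 - t) * sum p A + t * sum q A" for A
    by (simp add: sum.distrib sum_distrib_left)
  moreover have "1 \<le> (1 - t) * a + t * c" if "1 \<le> a" "1 \<le> c" for a c
  proof -
    have "(1 - t) * 1 + t * 1 \<le> (1 - t) * a + t * c"
      using assms(3,4) that by (intro add_mono mult_left_mono) auto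
    then show ?thesis by simp
  qed
  ultimately show ?thesis using assms by (auto simp: pm_polytope_def)
qed

text \<open>The weights at one vertex sum to 1, so the average over all edges is at least
  \<open>1 / card (edges G)\<close>. This bounds the infimum from below and makes \<open>L\<close>
  positive.\<close>

lemma L_feasible_lower_bound:
  assumes G: "finite_graph G" "even (card (verts G))" and z: "L_feasible G z b"
  shows "edges G \<noteq> {}" "1 / card (edges G) \<le> z"
proof -
  note finE = finite_graphD(2)[OF G(1)]
  have b: "b \<in> pm_polytope G" "\<forall>e\<in>edges G. b e \<le> z" using z L_feasible_iff[OF G] by auto
  obtain v where v: "v \<in> verts G" using G by (auto simp: finite_graph_def)
  then have deg: "sum b (incident_edges G v) = 1" using b(1) by (auto simp: pm_polytope_def)
  then have "incident_edges G v \<noteq> {}" by auto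
  then show E: "edges G \<noteq> {}" by (auto simp: incident_edges_def)
  have "1 \<le> sum b (edges G)"
    unfolding deg[symmetric]
    using b(1) finE by (intro sum_mono2) (auto simp: incident_edges_def pm_polytope_def)
  also have "\<dots> \<le> (\<Sum>e\<in>edges G. z)" using b(2) by (intro sum_mono) auto
  finally show "1 / card (edges G) \<le> z"
    using E finE by (simp add: divide_le_eq card_gt_0_iff mult.commute)
qed

lemma L_le:
  assumes "finite_graph G" "even (card (verts G))" "L_feasible G z b"
  shows "L G \<le> z"
  unfolding L_def
proof (rule cInf_lower)
  show "bdd_below {z |z b. L_feasible G z b}"
    using L_feasible_lower_bound(2)[OF assms(1,2)]
    by (intro bdd_belowI[of _ "1 / card (edges G)"]) auto
qed (use assms(3) in auto)

lemma L_feasible_perfect_matching: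
  assumes "finite_graph G" "perfect_matching G M"
  shows "L_feasible G 1 (indicator M)"
  using L_feasible_iff[OF assms(1) perfect_matching_even_card_verts[OF assms]]
    indicator_perfect_matching_in_pm_polytope[OF assms] by (auto simp: indicator_def)

lemma L_greatest:
  assumes "finite_graph G" "perfect_matching G M" "\<And>z b. L_feasible G z b \<Longrightarrow> c \<le> z"
  shows "c \<le> L G"
  unfolding L_def
  using assms(3) L_feasible_perfect_matching[OF assms(1,2)] by (intro cInf_greatest) auto

lemma L_pos:
  assumes "finite_graph G" "perfect_matching G M"
  shows "0 < L G"
proof -
  note even = perfect_matching_even_card_verts[OF assms]
  have "edges G \<noteq> {}"
    using L_feasible_lower_bound(1)[OF assms(1) even L_feasible_perfect_matching[OF assms]] .
  then have "0 < 1 / real (card (edges G))"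
    using finite_graphD(2)[OF assms(1)] by (simp add: card_gt_0_iff)
  also have "\<dots> \<le> L G"
    by (rule L_greatest[OF assms]) (rule L_feasible_lower_bound(2)[OF assms(1) even])
  finally show ?thesis .
qed

section \<open>The two inequalities between \<open>mp_f\<close> and \<open>1 / L\<close>\<close>

lemma sum_perfect_matching_eq_edge_dot:
  assumes "finite_graph G" "perfect_matching G M"
  shows "edge_dot G (indicator M) y = sum y M"
  by (rule edge_dot_indicator[OF assms(1)]) (use assms perfect_matching_iff in blast)

lemma mp_f_feasible_ge:
  assumes G: "finite_graph G" and M: "perfect_matching G M" and y: "mp_f_feasible G y"
  shows "1 / L G \<le> sum y (edges G)"
proof -
  note even = perfect_matching_even_card_verts[OF G M]
  have zy: "1 \<le> z * sum y (edges G)" if z: "L_feasible G z b" for z b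
  proof -
    have b: "b \<in> pm_polytope G" "\<forall>e\<in>edges G. b e \<le> z" using z L_feasible_iff[OF G even] by auto
    obtain N where N: "perfect_matching G N" "sum y N \<le> (\<Sum>e\<in>edges G. y e * b e)"
      using pm_polytope_dominates_pm[OF G even b(1)] by (auto simp: dominates_pm_def)
    have "1 \<le> sum y N"
      using y N(1) sum_perfect_matching_eq_edge_dot[OF G N(1), of y] by (auto simp: mp_f_feasible_def)
    also note N(2)
    also have "(\<Sum>e\<in>edges G. y e * b e) \<le> (\<Sum>e\<in>edges G. y e * z)"
      using y b(2) by (intro sum_mono mult_left_mono) (auto simp: mp_f_feasible_def)
    finally show ?thesis by (simp add: sum_distrib_left mult.commute)
  qed
  \<comment> \<open>The incidence vector of \<open>M\<close> is feasible with
    \<open>z = 1\<close>.\<close>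
  have pos: "0 < sum y (edges G)" using zy[OF L_feasible_perfect_matching[OF G M]] by simp
  have "1 / sum y (edges G) \<le> L G"
    by (rule L_greatest[OF G M]) (use zy pos in \<open>simp add: divide_le_eq\<close>)
  then show ?thesis using pos L_pos[OF G M] by (simp add: field_simps)
qed

lemma mp_f_feasible_attains:
  assumes G: "finite_graph G" and M0: "perfect_matching G M0"
  obtains y where "mp_f_feasible G y" "sum y (edges G) = 1 / L G"
proof -
  note finE = finite_graphD(2)[OF G] and even = perfect_matching_even_card_verts[OF G M0]
  have E_ne: "edges G \<noteq> {}"
    using L_feasible_lower_bound(1)[OF G even L_feasible_perfect_matching[OF G M0]] .
  \<comment> \<open>Shifting by \<open>L G\<close> turns points with all coordinates below
    \<open>L G\<close> into points of the negative orthant.\<close>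
  define K where "K = (\<lambda>b e. b e - L G) ` pm_polytope G"
  have convex: "(\<lambda>e. (1 - t) * x e + t * y e) \<in> K"
    if xy: "x \<in> K" "y \<in> K" and t: "0 \<le> t" "t \<le> 1" for x y t
  proof -
    obtain p q where pq: "p \<in> pm_polytope G" "q \<in> pm_polytope G"
      "x = (\<lambda>e. p e - L G)" "y = (\<lambda>e. q e - L G)" using xy by (auto simp: K_def)
    have "(\<lambda>e. (1 - t) * x e + t * y e) = (\<lambda>e. ((1 - t) * p e + t * q e) - L G)"
      by (auto simp: pq algebra_simps)
    then show ?thesis using pm_polytope_convex[OF pq(1,2) t] by (auto simp: K_def)
  qed
  \<comment> \<open>Such a point would be feasible with its largest coordinate as \<open>z\<close>,
    which is below \<open>L G\<close>.\<close>
  have no_neg: "\<not> (\<exists>x\<in>K. \<forall>e\<in>edges G. x e < 0)"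
  proof
    assume "\<exists>x\<in>K. \<forall>e\<in>edges G. x e < 0"
    then obtain b where b: "b \<in> pm_polytope G" "\<forall>e\<in>edges G. b e < L G" by (auto simp: K_def)
    have "L_feasible G (Max (b ` edges G)) b" using L_feasible_iff[OF G even] b(1) finE by auto
    then have "L G \<le> Max (b ` edges G)" by (rule L_le[OF G even])
    moreover have "Max (b ` edges G) < L G" using b(2) finE E_ne by simp
    ultimately show False by simp
  qed
  have "(\<exists>x\<in>K. \<forall>e\<in>edges G. x e < 0) \<or>
    (\<exists>y. (\<forall>e\<in>edges G. 0 \<le> y e) \<and> (\<Sum>e\<in>edges G. y e) = 1 \<and>
      (\<forall>x\<in>K. 0 \<le> (\<Sum>e\<in>edges G. y e * x e)))"
    by (rule convex_negative_point_or_nonneg_functional[OF finE E_ne convex])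
  with no_neg obtain y where y: "\<forall>e\<in>edges G. 0 \<le> y e" "sum y (edges G) = 1"
    "\<forall>x\<in>K. 0 \<le> (\<Sum>e\<in>edges G. y e * x e)" by blast
  \<comment> \<open>The incidence vector of \<open>M\<close> lies in the polytope; as
    \<open>y\<close> has total weight 1, its nonnegativity on the shifted vector is the
    bound.\<close>
  have "L G \<le> sum y M" if M: "perfect_matching G M" for M
  proof -
    have "(\<lambda>e. indicator M e - L G) \<in> K"
      using indicator_perfect_matching_in_pm_polytope[OF G M] by (auto simp: K_def)
    then have "0 \<le> (\<Sum>e\<in>edges G. y e * (indicator M e - L G))" using y(3) by auto
    also have "\<dots> = edge_dot G (indicator M) y - L G * sum y (edges G)"
      by (simp add: edge_dot_def right_diff_distrib sum_subtractf sum_distrib_left mult.commute)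
    finally show ?thesis using y(2) sum_perfect_matching_eq_edge_dot[OF G M] by simp
  qed
  then have "mp_f_feasible G (\<lambda>e. y e / L G)"
    using y(1) L_pos[OF G M0]
    by (auto simp: mp_f_feasible_def sum_perfect_matching_eq_edge_dot[OF G]
        sum_divide_distrib[symmetric])
  moreover have "(\<Sum>e\<in>edges G. y e / L G) = 1 / L G"
    using y(2) by (simp add: sum_divide_distrib[symmetric])
  ultimately show thesis by (rule that)
qed

theorem theorem2p5:
  fixes G :: "('v, 'e) ugraph"
  assumes "finite_graph G"
    and "\<exists>M. perfect_matching G M"
  shows "mp_f G = 1 / L G"
proof -
  obtain M where M: "perfect_matching G M" using assms(2) by blast
  obtain y where y: "mp_f_feasible G y" "sum y (edges G) = 1 / L G"
    by (rule mp_f_feasible_attains[OF assms(1) M])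
  have dot: "edge_dot G (\<lambda>_. 1) y = sum y (edges G)" for y by (simp add: edge_dot_def)
  show ?thesis
    unfolding mp_f_def dot
  proof (rule cInf_eq_minimum)
    show "1 / L G \<in> {sum y (edges G) |y. mp_f_feasible G y}" using y by force
  qed (use mp_f_feasible_ge[OF assms(1) M] in blast)
qed

end
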